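(* Let $K$ be a compact metric space and let $f \colon S_{\ell_\infty} \to K$ be a weak-* Borel, uniformly continuous map. Then $f$ stabilizes; that is, for every $\varepsilon > 0$ there exists a vector subspace $Y \subseteq \ell_\infty$ linearly isometric to $\ell_\infty$ such that $\operatorname{osc}(f\restriction_{S_Y}) \leqslant \varepsilon$.
   Context: $\ell_\infty$ is the real Banach space of all bounded sequences $x \colon \mathbb{N} \to \mathbb{R}$ with the norm $\|x\|_\infty = \sup_{n \in \mathbb{N}} |x(n)|$. For a Banach space $X$, $S_X$ denotes its unit sphere, i.e. the set of its vectors of norm $1$. Uniform continuity is with respect to the norm metric. The weak-* topology on $\ell_\infty$ is the one obtained by viewing $\ell_\infty$ as the dual of $\ell_1$; on $S_{\ell_\infty}$ it coincides with the topology induced by the product topology on $\mathbb{R}^{\mathbb{N}}$. The map $f$ is weak-* Borel if it is Borel measurable when $S_{\ell_\infty}$ carries the weak-* topology. For a map $g \colon A \to M$ into a metric space $M$, $\operatorname{osc}(g) = \sup_{x,y \in A} d(g(x), g(y))$. *)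

theory Defs
  imports "HOL-Analysis.Analysis"
begin

text \<open>
  The space \<open>nat\<close> is discrete, so every bounded real sequence is a bounded continuous function
  and the library's Banach space of such functions, with the supremum norm, is \<open>\<ell>\<^sub>\<infinity>\<close>; the two
  lemmas below confirm this.
\<close>

type_synonym linf = "nat \<Rightarrow>\<^sub>C real"

lemma bounded_seq_in_linf:
  fixes x :: "nat \<Rightarrow> real"
  shows "x \<in> bcontfun \<longleftrightarrow> bounded (range x)"
  by (auto simp: bcontfun_def continuous_on_discrete)

lemma norm_linf:
  fixes x :: linf
  shows "norm x = (SUP n. \<bar>apply_bcontfun x n\<bar>)"
  by (simp add: norm_bcontfun_def dist_bcontfun_def)

text \<open>
  The coarsest topology on \<open>\<ell>\<^sub>\<infinity>\<close> that makes the pairing with each \<open>a \<in> \<ell>\<^sub>1\<close> continuous.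
\<close>

definition weak_star_linf :: "linf topology" where
  "weak_star_linf = topology_generated_by
     {{x. (\<Sum>n. a n * apply_bcontfun x n) \<in> U} | (a :: nat \<Rightarrow> real) U.
        summable (\<lambda>n. \<bar>a n\<bar>) \<and> open U}"

definition borel_of_topology :: "'a topology \<Rightarrow> 'a measure" where
  "borel_of_topology T = sigma (topspace T) {U. openin T U}"

definition linearly_isometric_to_linf :: "'a::real_normed_vector set \<Rightarrow> bool" where
  "linearly_isometric_to_linf Y \<longleftrightarrow>
     (\<exists>T :: linf \<Rightarrow> 'a. linear T \<and> (\<forall>x. norm (T x) = norm x) \<and> range T = Y)"

text \<open>The supremum is taken in \<open>[0, \<infinity>]\<close>, so no boundedness or nonemptiness is presupposed.\<close>

definition osc :: "'a set \<Rightarrow> ('a \<Rightarrow> 'b::metric_space) \<Rightarrow> ennreal" where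
  "osc A g = (SUP x\<in>A. SUP y\<in>A. ennreal (dist (g x) (g y)))"

definition stabilizes :: "(linf \<Rightarrow> 'k::metric_space) \<Rightarrow> bool" where
  "stabilizes f \<longleftrightarrow>
     (\<forall>\<epsilon>>0. \<exists>Y :: linf set. subspace Y \<and> linearly_isometric_to_linf Y \<and>
        osc (Y \<inter> sphere 0 1) f \<le> ennreal \<epsilon>)"

end

theory Submission
  imports Defs
begin

text \<open>
  Fix \<open>\<rho> < 1\<close> close to \<open>1\<close> and \<open>k\<close> with \<open>\<rho>\<^sup>k\<close> small. A sequence of letters from \<open>{0..k}\<close> is read as
  an element of the unit ball of \<open>\<ell>\<^sub>\<infinity>\<close>, the letter \<open>l > 0\<close> having the value \<open>(-\<rho>)\<^bsup>k-l\<^esup>\<close> and \<open>0\<close> the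
  value \<open>0\<close> (\<open>tetris\<close>); the result has norm \<open>1\<close> as soon as the letter \<open>k\<close> occurs. Lowering all
  letters by \<open>1\<close> then multiplies the vector by \<open>-\<rho>\<close>, up to a small error. Hence multiplication by
  an arbitrary scalar of \<open>[-1,1]\<close> is approximated by an iterate of this one operation on words.
  The alternating sign makes it reach the negative scalars as well, so that no separate argument
  is needed to compare a vector with its negative.

  Cover \<open>K\<close> by finitely many small balls. The preimage of each ball is weak-* Borel and thus gives a
  Borel set of letter sequences, which has the property of Baire: for a countable family of dense
  sets of finite words, every sequence that meets all of them (a generic sequence) knows from a
  finite prefix on which side of the Borel set it lies (\<open>decided_weak_star_borel\<close>).

  As in the proof of Gowers' theorem on \<open>c\<^sub>0\<close>, the combinatorial core is an ultrafilter \<open>p\<close> on finite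
  words such that \<open>T\<^sup>j(p)\<close> followed by \<open>p\<close> is again \<open>p\<close> for all \<open>j \<ge> 1\<close>, where \<open>T\<close> lowers the letters
  (\<open>absorbing_ultrafilter\<close>). Such a \<open>p\<close> exists inside any nonempty closed two-sided ideal, by repeated
  use of the Ellis idempotent lemma, and the ideal can be chosen so that \<open>p\<close>-almost every word, after any
  prefix whatsoever, lies in each of the countably many dense sets. Consequently \<open>p\<close>-almost every
  word decides all the Borel sets, and does so in one fixed way.

  A recursion now chooses blocks of letters \<open>u\<^sub>0, u\<^sub>1, \<dots>\<close>, the block \<open>u\<^sub>n\<close> belonging to a coordinate
  \<open>v\<^sub>n\<close>, in which every coordinate recurs infinitely often (\<open>block_sequence\<close>). Whatever shift is
  applied to the blocks of each coordinate, if for some coordinate it is one of the two smallest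
  ones, then the concatenation is generic and has a prefix that decides all the Borel sets in the
  fixed way. Ramsey theory enters only up to the moment of decision; afterwards a
  decision cannot be undone, and the recurrence of coordinates secures genericity.

  The subspace consists of the vectors obtained from \<open>y \<in> \<ell>\<^sub>\<infinity>\<close> by filling the block \<open>u\<^sub>n\<close> with
  \<open>y(v\<^sub>n)\<close> times the values of its letters. If \<open>y\<close> has norm \<open>1\<close>, rounding its entries to the numbers
  \<open>(-\<rho>)\<^sup>j\<close> changes this vector into one of the concatenations above, up to an error that the uniform
  continuity of \<open>f\<close> absorbs.
\<close>

section \<open>Idempotents of compact semigroups\<close>

text \<open>
  The Ellis--Numakura lemma. In a minimal compact subsemigroup \<open>A\<close> with element \<open>e\<close>, both
  \<open>A e\<close> and \<open>{x \<in> A. x e = e}\<close> are compact subsemigroups, hence all of \<open>A\<close>; so \<open>e e = e\<close>.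
\<close>

lemma compact_semigroup_idempotent:
  fixes S :: "'a::t2_space set" and m :: "'a \<Rightarrow> 'a \<Rightarrow> 'a"
  assumes "compact S" "S \<noteq> {}"
    and closed: "\<And>x y. x \<in> S \<Longrightarrow> y \<in> S \<Longrightarrow> m x y \<in> S"
    and assoc: "\<And>x y z. x \<in> S \<Longrightarrow> y \<in> S \<Longrightarrow> z \<in> S \<Longrightarrow> m (m x y) z = m x (m y z)"
    and cont: "\<And>y. y \<in> S \<Longrightarrow> continuous_on S (\<lambda>x. m x y)"
  shows "\<exists>e\<in>S. m e e = e"
proof -
  define \<A> where "\<A> = {A. A \<subseteq> S \<and> compact A \<and> A \<noteq> {} \<and> (\<forall>x\<in>A. \<forall>y\<in>A. m x y \<in> A)}"
  have "\<exists>A\<in>\<A>. \<forall>B\<in>\<A>. B \<subseteq> A \<longrightarrow> B = A"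
  proof (rule predicate_Zorn)
    show "partial_order_on \<A> (relation_of (\<lambda>A B. B \<subseteq> A) \<A>)"
      by (rule partial_order_on_relation_ofI) auto
  next
    fix C assume C: "C \<in> Chains (relation_of (\<lambda>A B. B \<subseteq> A) \<A>)"
    then have CA: "C \<subseteq> \<A>" and chain: "\<And>A B. A \<in> C \<Longrightarrow> B \<in> C \<Longrightarrow> A \<subseteq> B \<or> B \<subseteq> A"
      by (auto simp: Chains_def relation_of_def)
    have "S \<inter> \<Inter>C \<noteq> {}"
    proof (rule compact_imp_fip[OF \<open>compact S\<close>])
      show "closed A" if "A \<in> C" for A
        using that CA by (auto simp: \<A>_def intro: compact_imp_closed)
      show "S \<inter> \<Inter>F \<noteq> {}" if "finite F" "F \<subseteq> C" for F
      proof (cases "F = {}")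
        case False
        then have "\<Inter>F \<in> F"
          using that chain by (intro finite_Inf_in) (metis inf.absorb1 inf.absorb2 subsetD)+
        then have "\<Inter>F \<in> \<A>" using that CA by blast
        then show ?thesis by (auto simp: \<A>_def inf.absorb2)
      qed (use \<open>S \<noteq> {}\<close> in auto)
    qed
    moreover have "closed (\<Inter>C)"
      using CA by (intro closed_Inter) (auto simp: \<A>_def intro: compact_imp_closed)
    ultimately have "S \<inter> \<Inter>C \<in> \<A>"
      using CA \<open>compact S\<close> closed by (auto simp: \<A>_def intro!: compact_Int_closed)
    then show "\<exists>u\<in>\<A>. \<forall>a\<in>C. u \<subseteq> a" by (rule rev_bexI) auto
  qed
  then obtain A where A: "A \<in> \<A>" and min: "\<And>B. B \<in> \<A> \<Longrightarrow> B \<subseteq> A \<Longrightarrow> B = A" by blast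
  then have AS: "A \<subseteq> S" "compact A" "A \<noteq> {}" and mA: "\<And>x y. x \<in> A \<Longrightarrow> y \<in> A \<Longrightarrow> m x y \<in> A"
    by (auto simp: \<A>_def)
  obtain e where e: "e \<in> A" using \<open>A \<noteq> {}\<close> by auto
  have contA: "continuous_on A (\<lambda>x. m x e)" using cont e AS by (meson continuous_on_subset subsetD)
  have "(\<lambda>x. m x e) ` A = A"
  proof (rule min)
    have "m (m x e) (m y e) = m (m (m x e) y) e" if "x \<in> A" "y \<in> A" for x y
      using that e AS assoc closed by (metis subsetD)
    then show "(\<lambda>x. m x e) ` A \<in> \<A>"
      using AS e mA contA by (auto simp: \<A>_def intro!: compact_continuous_image)
  qed (use mA e in auto)
  then obtain z where z: "z \<in> A" "m z e = e" using e by (metis imageE)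
  have "{x \<in> A. m x e = e} = A"
  proof (rule min)
    have "closedin (top_of_set A) {x \<in> A. m x e = e}"
      using continuous_closedin_preimage_constant[OF contA] by simp
    then have "compact {x \<in> A. m x e = e}"
      using \<open>compact A\<close> closedin_compact by blast
    moreover have "m (m x y) e = e" if "x \<in> A" "y \<in> A" "m x e = e" "m y e = e" for x y
      using that e AS assoc by (metis subsetD)
    ultimately show "{x \<in> A. m x e = e} \<in> \<A>"
      using AS z mA by (auto simp: \<A>_def)
  qed auto
  with e have "e \<in> {x \<in> A. m x e = e}" by (simp only:)
  then show ?thesis using AS by blast
qed

text \<open>
  Descending induction on \<open>a\<close> produces an idempotent \<open>e \<in> T\<^sup>a(R)\<close> with \<open>e (T e) = e = (T e) e\<close>.
  For \<open>a = k\<close> the map \<open>T\<close> is the identity on \<open>T\<^sup>a(R)\<close>. Given such a \<open>p\<close> for \<open>a + 1\<close>, the elements \<open>q\<close>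
  with \<open>T q = p\<close> and \<open>q p = q\<close> form a compact semigroup; these conditions survive limits because
  multiplication is continuous in its left argument, while \<open>p q = q\<close> need not. An idempotent \<open>q\<close> of
  this semigroup becomes two-sided as \<open>e = p q\<close>. Working in the sets \<open>T\<^sup>a(R)\<close> from the start is what
  guarantees that \<open>p\<close> has preimages in the ideal.
\<close>

lemma idempotent_absorbing_shifts:
  fixes S R :: "'a::t2_space set" and m :: "'a \<Rightarrow> 'a \<Rightarrow> 'a" and T :: "'a \<Rightarrow> 'a"
  assumes R: "R \<subseteq> S" "compact R" "R \<noteq> {}"
    and closed: "\<And>x y. x \<in> S \<Longrightarrow> y \<in> S \<Longrightarrow> m x y \<in> S"
    and assoc: "\<And>x y z. x \<in> S \<Longrightarrow> y \<in> S \<Longrightarrow> z \<in> S \<Longrightarrow> m (m x y) z = m x (m y z)"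
    and cont: "\<And>y. y \<in> S \<Longrightarrow> continuous_on S (\<lambda>x. m x y)"
    and ideal: "\<And>x y. x \<in> S \<Longrightarrow> y \<in> R \<Longrightarrow> m x y \<in> R" "\<And>x y. x \<in> R \<Longrightarrow> y \<in> S \<Longrightarrow> m x y \<in> R"
    and T: "\<And>x. x \<in> S \<Longrightarrow> T x \<in> S" "continuous_on S T"
    and hom: "\<And>x y. x \<in> S \<Longrightarrow> y \<in> S \<Longrightarrow> T (m x y) = m (T x) (T y)"
    and stable: "\<And>x. x \<in> S \<Longrightarrow> T ((T ^^ k) x) = (T ^^ k) x"
  shows "\<exists>p\<in>R. \<forall>j\<ge>1. m ((T ^^ j) p) p = p"
proof -
  have TS: "(T ^^ a) x \<in> S" if "x \<in> S" for a x
    using that by (induction a) (auto intro: T)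
  have homa: "(T ^^ a) (m x y) = m ((T ^^ a) x) ((T ^^ a) y)" if "x \<in> S" "y \<in> S" for a x y
    using that by (induction a) (auto simp: hom TS)
  have conta: "continuous_on S (T ^^ a)" for a
  proof (induction a)
    case (Suc a)
    have "continuous_on ((T ^^ a) ` S) T"
      using TS by (intro continuous_on_subset[OF T(2)]) auto
    from continuous_on_compose[OF Suc this] show ?case by (simp add: o_def)
  qed (simp add: id_def)
  define R' where "R' a = (T ^^ a) ` R" for a
  have R'S: "R' a \<subseteq> S" for a using R TS by (auto simp: R'_def)
  have compact: "compact (R' a)" for a
    unfolding R'_def by (intro compact_continuous_image R continuous_on_subset[OF conta])
  have R'_ideal: "m x ((T ^^ a) y) \<in> R' a" "m ((T ^^ a) y) x \<in> R' a" if "x \<in> R' a" "y \<in> S" for x y a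
    using that ideal R homa unfolding R'_def by (smt (verit) imageE image_eqI subsetD)+
  have R'_anti: "\<exists>y\<in>S. x = (T ^^ a) y" if "x \<in> R' (Suc a)" for x a
    using that R T unfolding R'_def by (auto simp: funpow_swap1 simp del: funpow.simps)
       (metis funpow_Suc_right o_apply subsetD)
  have semigroup: "m x y \<in> R' a" if "x \<in> R' a" "y \<in> R' a" for x y a
    using that R R'_ideal unfolding R'_def by blast
  define P where "P a \<longleftrightarrow> (\<exists>e\<in>R' a. m e e = e \<and> m e (T e) = e \<and> m (T e) e = e)" for a
  have "P 0"
  proof (rule inc_induct[of 0 k])
    have "\<exists>e\<in>R' k. m e e = e"
    proof (rule compact_semigroup_idempotent[OF compact, where m = m])
      show "R' k \<noteq> {}" using R by (auto simp: R'_def)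
      show "continuous_on (R' k) (\<lambda>x. m x y)" if "y \<in> R' k" for y
        using that R'S cont by (meson continuous_on_subset subsetD)
    qed (use R'S semigroup assoc in blast)+
    moreover have "T e = e" if "e \<in> R' k" for e
      using that stable R by (auto simp: R'_def)
    ultimately show "P k" unfolding P_def by metis
  next
    fix a assume "P (Suc a)"
    then obtain p where p: "p \<in> R' (Suc a)" "m p p = p" "m p (T p) = p" "m (T p) p = p"
      unfolding P_def by blast
    have pS: "p \<in> S" "T p \<in> S" using p R'S T by blast+
    \<comment> \<open>Nonempty: if \<open>r \<in> R' a\<close> is a preimage of \<open>p\<close>, the product \<open>r p\<close> belongs to it.\<close>
    define M where "M = {q \<in> R' a. T q = p} \<inter> {q \<in> R' a. m q p = q}"
    have MS: "M \<subseteq> S" using R'S by (auto simp: M_def)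
    have "\<exists>q\<in>M. m q q = q"
    proof (rule compact_semigroup_idempotent[where m = m])
      have "compact {q \<in> R' a. f q = g q}" if "continuous_on S f" "continuous_on S g" for f g :: "'a \<Rightarrow> 'a"
      proof -
        have "continuous_on (R' a) (\<lambda>q. (f q, g q))"
          using that R'S by (intro continuous_on_Pair) (meson continuous_on_subset)+
        then have "closed (R' a \<inter> (\<lambda>q. (f q, g q)) -` {y. \<exists>x. y = (x, x)})"
          by (rule continuous_closed_preimage[OF _ compact_imp_closed[OF compact] closed_diagonal])
        moreover have "R' a \<inter> (\<lambda>q. (f q, g q)) -` {y. \<exists>x. y = (x, x)} = {q \<in> R' a. f q = g q}"
          by auto
        ultimately have "compact (R' a \<inter> {q \<in> R' a. f q = g q})"
          using compact_Int_closed[OF compact] by simp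
        moreover have "R' a \<inter> {q \<in> R' a. f q = g q} = {q \<in> R' a. f q = g q}" by auto
        ultimately show ?thesis by simp
      qed
      then show "compact M"
        unfolding M_def using T(2) cont[OF pS(1)]
        by (intro compact_Int) (auto intro: continuous_intros)
      obtain r where r: "r \<in> R' a" "p = T r" using p(1) by (auto simp: R'_def)
      obtain y where y: "y \<in> S" "p = (T ^^ a) y" using R'_anti[OF p(1)] by blast
      have "m r p \<in> R' a" using R'_ideal(1)[OF r(1) y(1)] y(2) by simp
      moreover have "T (m r p) = p" using hom[of r p] r R'S pS p by auto
      moreover have "m (m r p) p = m r p" using assoc[of r p p] r R'S pS p by auto
      ultimately show "M \<noteq> {}" by (auto simp: M_def)
      show "m x y \<in> M" if "x \<in> M" "y \<in> M" for x y
      proof -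
        have "x \<in> S" "y \<in> S" using that MS by blast+
        then show ?thesis
          using that hom[of x y] assoc[of x y p] pS p semigroup by (auto simp: M_def)
      qed
      show "continuous_on M (\<lambda>x. m x y)" if "y \<in> M" for y
        using that MS cont by (meson continuous_on_subset subsetD)
    qed (use MS assoc in blast)
    then obtain q where q: "q \<in> R' a" "T q = p" "m q p = q" "m q q = q" by (auto simp: M_def)
    have qS: "q \<in> S" using q R'S by blast
    obtain y where y: "y \<in> S" "p = (T ^^ a) y" using R'_anti[OF p(1)] by blast
    define e where "e = m p q"
    have "e \<in> R' a" using R'_ideal(2)[OF q(1) y(1)] y(2) by (simp add: e_def)
    moreover have "T e = p" using hom[OF pS(1) qS] q p by (simp add: e_def)
    moreover have "m p e = e" using assoc[OF pS(1) pS(1) qS] p by (simp add: e_def)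
    moreover have "m e p = e" using assoc[OF pS(1) qS pS(1)] q by (simp add: e_def)
    moreover from this have "m e e = e"
      using assoc[of e p q] pS qS closed[OF pS(1) qS] assoc[OF pS(1) qS qS] q by (simp add: e_def)
    ultimately show "P a" unfolding P_def by metis
  qed simp
  then obtain e where e: "e \<in> R" "m e e = e" "m (T e) e = e"
    unfolding P_def R'_def by auto
  then have eS: "e \<in> S" using R by blast
  have "m ((T ^^ j) e) e = e" if "j \<ge> 1" for j
    using that
  proof (induction rule: dec_induct)
    case (step j)
    have "m ((T ^^ Suc j) e) e = m (T ((T ^^ j) e)) (m (T e) e)" using e by simp
    also have "\<dots> = m (m (T ((T ^^ j) e)) (T e)) e"
      using assoc T TS eS by metis
    also have "\<dots> = m (T (m ((T ^^ j) e) e)) e" using hom TS eS by metis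
    finally show ?case using step e by simp
  qed (use e in simp)
  with e show ?thesis by blast
qed

section \<open>Ultrafilters\<close>

text \<open>
  An ultrafilter is encoded as the quantifier ``for almost all'', that is, a predicate on
  predicates commuting with conjunction and negation. Products and images of ultrafilters then
  become compositions of quantifiers, and their algebraic laws hold by computation.
\<close>

typedef 'a ultrafilter =
  "{U :: ('a \<Rightarrow> bool) \<Rightarrow> bool. (\<forall>P Q. U (\<lambda>x. P x \<and> Q x) = (U P \<and> U Q)) \<and> (\<forall>P. U (\<lambda>x. \<not> P x) = (\<not> U P))}"
  morphisms mostly Abs_ultrafilter
  by (rule exI[of _ "\<lambda>P. P undefined"]) simp

lemma mostly_conj [simp]: "mostly U (\<lambda>x. P x \<and> Q x) \<longleftrightarrow> mostly U P \<and> mostly U Q"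
  and mostly_not [simp]: "mostly U (\<lambda>x. \<not> P x) \<longleftrightarrow> \<not> mostly U P"
  using mostly[of U] by blast+

lemma ultrafilter_eqI: "(\<And>P. mostly U P = mostly V P) \<Longrightarrow> U = V"
  by (simp add: mostly_inject[symmetric] fun_eq_iff)

lemma mostly_True [simp]: "mostly U (\<lambda>x. True)"
  using mostly_not[of U "\<lambda>x. False"] mostly_conj[of U "\<lambda>x. True" "\<lambda>x. False"] by auto

lemma mostly_mono: "mostly U P \<Longrightarrow> (\<And>x. P x \<Longrightarrow> Q x) \<Longrightarrow> mostly U Q"
proof -
  assume "mostly U P" and PQ: "\<And>x. P x \<Longrightarrow> Q x"
  moreover have "P = (\<lambda>x. P x \<and> Q x)" using PQ by auto
  ultimately show "mostly U Q" using mostly_conj[of U P Q] by simp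
qed

lemma mostly_const [simp]: "mostly U (\<lambda>x. P) = P"
  using mostly_not[of U "\<lambda>x. True"] by (cases P) auto

lemma mostly_cong:
  assumes "mostly U A" "\<And>x. A x \<Longrightarrow> P x = Q x"
  shows "mostly U P = mostly U Q"
proof -
  have "(\<lambda>x. A x \<and> P x) = (\<lambda>x. A x \<and> Q x)" using assms(2) by blast
  then have "mostly U (\<lambda>x. A x \<and> P x) = mostly U (\<lambda>x. A x \<and> Q x)" by (rule arg_cong)
  then show ?thesis using assms(1) by simp
qed

lemma mostly_ball_finite:
  assumes "finite I"
  shows "mostly U (\<lambda>x. \<forall>i\<in>I. P i x) \<longleftrightarrow> (\<forall>i\<in>I. mostly U (P i))"
  using assms by induction auto

lemma mostly_ex: "mostly U P \<Longrightarrow> \<exists>x. P x"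
  using mostly_mono[of U P "\<lambda>x. False"] by auto

lemma mostly_Abs:
  assumes "\<And>P Q. U (\<lambda>x. P x \<and> Q x) = (U P \<and> U Q)" "\<And>P. U (\<lambda>x. \<not> P x) = (\<not> U P)"
  shows "mostly (Abs_ultrafilter U) = U"
  using assms by (intro Abs_ultrafilter_inverse) auto

text \<open>
  This is the Stone topology of the Cech--Stone compactification, as a subspace of a power of the
  two-point space.
\<close>

instantiation ultrafilter :: (type) t2_space
begin

definition open_ultrafilter :: "'a ultrafilter set \<Rightarrow> bool"
  where "open_ultrafilter A \<longleftrightarrow> (\<exists>V. open V \<and> A = mostly -` V)"

instance
proof
  show "open (UNIV :: 'a ultrafilter set)"
    unfolding open_ultrafilter_def by (intro exI[of _ UNIV]) auto
  show "open (A \<inter> B)" if "open A" "open B" for A B :: "'a ultrafilter set"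
    using that unfolding open_ultrafilter_def by (metis open_Int vimage_Int)
  show "open (\<Union>K)" if K: "\<forall>A\<in>K. open A" for K :: "'a ultrafilter set set"
  proof -
    obtain V where "\<forall>A\<in>K. open (V A) \<and> A = mostly -` V A"
      using K unfolding open_ultrafilter_def by metis
    then show ?thesis
      unfolding open_ultrafilter_def by (intro exI[of _ "\<Union>(V ` K)"]) auto
  qed
  fix U V :: "'a ultrafilter"
  assume "U \<noteq> V"
  then obtain P where "mostly U P \<noteq> mostly V P" by (metis ultrafilter_eqI)
  moreover have "open {W. mostly W P = b}" for b
  proof -
    have "open ((\<lambda>f. f P) -` {b})"
      by (intro open_vimage continuous_on_product_coordinates) (simp add: open_discrete)
    then show ?thesis
      unfolding open_ultrafilter_def by (intro exI[of _ "(\<lambda>f. f P) -` {b}"]) auto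
  qed
  ultimately show "\<exists>A B. open A \<and> open B \<and> U \<in> A \<and> V \<in> B \<and> A \<inter> B = {}"
    by (intro exI[of _ "{W. mostly W P = mostly U P}"] exI[of _ "{W. mostly W P = mostly V P}"]) auto
qed

end

lemma continuous_on_mostly: "continuous_on A (\<lambda>U. mostly U P)"
proof -
  have "continuous_on UNIV (mostly :: 'a ultrafilter \<Rightarrow> _)"
    unfolding continuous_on_open_vimage[OF open_UNIV] by (auto simp: open_ultrafilter_def)
  from continuous_on_product_then_coordinatewise[OF continuous_on_subset[OF this subset_UNIV]]
  show ?thesis .
qed

lemma continuous_on_ultrafilterI:
  assumes "\<And>P. continuous_on A (\<lambda>x. mostly (f x) P)"
  shows "continuous_on A f"
proof -
  have "continuous_on A (\<lambda>x. mostly (f x))"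
    using assms by (intro continuous_on_coordinatewise_then_product)
  then have "\<forall>V. open V \<longrightarrow> (\<exists>B. open B \<and> B \<inter> A = f -` mostly -` V \<inter> A)"
    unfolding continuous_on_open_invariant vimage_comp comp_def .
  then show ?thesis
    unfolding continuous_on_open_invariant open_ultrafilter_def by blast
qed

lemma closed_mostly: "closed {U. mostly U P}"
  using closed_Collect_eq[OF continuous_on_mostly[of UNIV P] continuous_on_const[of UNIV True]] by simp

text \<open>
  Tychonoff's theorem for powers of a compact space.
\<close>

lemma compact_UNIV_fun:
  assumes "compact (UNIV :: 'b::topological_space set)"
  shows "compact (UNIV :: ('a \<Rightarrow> 'b) set)"
proof -
  have "compactin (product_topology (\<lambda>i::'a. euclidean :: 'b topology) UNIV) (PiE UNIV (\<lambda>_. UNIV))"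
    unfolding compactin_PiE using assms by simp
  then show ?thesis by (simp add: euclidean_product_topology)
qed

lemma compact_UNIV_ultrafilter: "compact (UNIV :: 'a ultrafilter set)"
proof -
  have pos: "closed {U :: ('a \<Rightarrow> bool) \<Rightarrow> bool. U P}"
    and neg: "closed {U :: ('a \<Rightarrow> bool) \<Rightarrow> bool. \<not> U P}" for P
  proof -
    have "closed ((\<lambda>U :: ('a \<Rightarrow> bool) \<Rightarrow> bool. U P) -` {b})" for b
      by (intro closed_vimage continuous_on_product_coordinates closed_singleton)
    from this[of True] this[of False]
    show "closed {U :: ('a \<Rightarrow> bool) \<Rightarrow> bool. U P}" "closed {U :: ('a \<Rightarrow> bool) \<Rightarrow> bool. \<not> U P}"
      by (simp_all add: vimage_def)
  qed
  have "closed (range (mostly :: 'a ultrafilter \<Rightarrow> _))"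
    unfolding type_definition.Rep_range[OF type_definition_ultrafilter]
      iff_conv_conj_imp imp_conv_disj de_Morgan_conj not_not
    by (intro closed_Collect_conj closed_Collect_all closed_Collect_disj pos neg)
  moreover have "compact (UNIV :: (('a \<Rightarrow> bool) \<Rightarrow> bool) set)"
    by (intro compact_UNIV_fun finite_imp_compact) simp
  ultimately have "compact (range (mostly :: 'a ultrafilter \<Rightarrow> _))"
    using compact_Int_closed by fastforce
  moreover have "continuous_on (range (mostly :: 'a ultrafilter \<Rightarrow> _)) Abs_ultrafilter"
  proof (rule continuous_on_ultrafilterI)
    fix P :: "'a \<Rightarrow> bool"
    have "continuous_on (range mostly) (\<lambda>U. U P)"
      by (rule continuous_on_subset[OF continuous_on_product_coordinates subset_UNIV])
    then show "continuous_on (range mostly) (\<lambda>U. mostly (Abs_ultrafilter U) P)"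
      by (rule continuous_on_eq) (auto simp: mostly_inverse)
  qed
  ultimately have "compact (Abs_ultrafilter ` range (mostly :: 'a ultrafilter \<Rightarrow> _))"
    by (rule compact_continuous_image[rotated])
  then show ?thesis by (simp add: image_image mostly_inverse)
qed

definition map_ultrafilter :: "('a \<Rightarrow> 'b) \<Rightarrow> 'a ultrafilter \<Rightarrow> 'b ultrafilter"
  where "map_ultrafilter f U = Abs_ultrafilter (\<lambda>P. mostly U (\<lambda>x. P (f x)))"

text \<open>
  The extension of concatenation to ultrafilters, continuous in the left argument. A word is typical
  for \<open>U \<odot> V\<close> if it starts with a \<open>U\<close>-typical word and continues with a \<open>V\<close>-typical one, where what
  counts as typical for the continuation may depend on the beginning.
\<close>

definition append_ultrafilter :: "'a list ultrafilter \<Rightarrow> 'a list ultrafilter \<Rightarrow> 'a list ultrafilter"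
  (infixr "\<odot>" 70)
  where "U \<odot> V = Abs_ultrafilter (\<lambda>P. mostly U (\<lambda>s. mostly V (\<lambda>t. P (s @ t))))"

lemma mostly_map [simp]: "mostly (map_ultrafilter f U) P \<longleftrightarrow> mostly U (\<lambda>x. P (f x))"
  by (simp add: map_ultrafilter_def mostly_Abs)

lemma mostly_append [simp]: "mostly (U \<odot> V) P \<longleftrightarrow> mostly U (\<lambda>s. mostly V (\<lambda>t. P (s @ t)))"
  by (simp add: append_ultrafilter_def mostly_Abs)

lemma append_ultrafilter_assoc: "(U \<odot> V) \<odot> W = U \<odot> (V \<odot> W)"
  by (rule ultrafilter_eqI) simp

lemma map_append_ultrafilter:
  "map_ultrafilter (map f) (U \<odot> V) = map_ultrafilter (map f) U \<odot> map_ultrafilter (map f) V"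
  by (rule ultrafilter_eqI) simp

lemma continuous_on_append_ultrafilter: "continuous_on A (\<lambda>U. U \<odot> V)"
  by (rule continuous_on_ultrafilterI) (simp add: continuous_on_mostly)

lemma continuous_on_map_ultrafilter: "continuous_on A (map_ultrafilter f)"
  by (rule continuous_on_ultrafilterI) (simp add: continuous_on_mostly)

lemma compact_mostly_all: "compact {U. \<forall>P\<in>\<P>. mostly U P}"
proof -
  have "closed (\<Inter>P\<in>\<P>. {U. mostly U P})" by (intro closed_INT ballI closed_mostly)
  then show ?thesis using compact_Int_closed[OF compact_UNIV_ultrafilter] by (simp add: Collect_ball_eq)
qed

lemma ultrafilter_exists:
  assumes "\<And>F. finite F \<Longrightarrow> F \<subseteq> \<P> \<Longrightarrow> \<exists>x. \<forall>P\<in>F. P x"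
  shows "\<exists>U. \<forall>P\<in>\<P>. mostly U P"
proof -
  have "UNIV \<inter> (\<Inter>P\<in>\<P>. {U. mostly U P}) \<noteq> {}"
  proof (rule compact_imp_fip_image[OF compact_UNIV_ultrafilter closed_mostly])
    fix F assume "finite F" "F \<subseteq> \<P>"
    then obtain x where x: "\<forall>P\<in>F. P x" using assms by blast
    have "mostly (Abs_ultrafilter (\<lambda>P. P x)) = (\<lambda>P. P x)" by (rule mostly_Abs) auto
    then have "Abs_ultrafilter (\<lambda>P. P x) \<in> UNIV \<inter> (\<Inter>P\<in>F. {U. mostly U P})" using x by auto
    then show "UNIV \<inter> (\<Inter>P\<in>F. {U. mostly U P}) \<noteq> {}" by blast
  qed
  then show ?thesis by auto
qed

section \<open>Baire category for infinite words\<close>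

text \<open>
  A dense open subset of the space of all sequences over \<open>A\<close>, given by the set of prefixes that
  force membership in it. The right ideal property expresses openness.
\<close>

definition dense_ideal :: "'a set \<Rightarrow> 'a list set \<Rightarrow> bool"
  where "dense_ideal A J \<longleftrightarrow>
    (\<forall>s\<in>J. \<forall>t\<in>lists A. s @ t \<in> J) \<and> (\<forall>s\<in>lists A. \<exists>t\<in>lists A. s @ t \<in> J)"

text \<open>
  Membership in the intersection of the dense open sets coded by \<open>\<J>\<close>.
\<close>

definition generic :: "'a list set set \<Rightarrow> (nat \<Rightarrow> 'a) \<Rightarrow> bool"
  where "generic \<J> x \<longleftrightarrow> (\<forall>J\<in>\<J>. \<exists>n. map x [0..<n] \<in> J)"

definition forces :: "'a set \<Rightarrow> 'a list set set \<Rightarrow> (nat \<Rightarrow> 'a) set \<Rightarrow> 'a list \<Rightarrow> bool"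
  where "forces A \<J> B s \<longleftrightarrow>
    (\<forall>x. range x \<subseteq> A \<and> generic \<J> x \<and> map x [0..<length s] = s \<longrightarrow> x \<in> B)"

text \<open>
  The property of Baire, phrased with prefixes: outside a meager set, membership in \<open>B\<close> is settled by
  a finite prefix. The deciding prefixes are required to be one of the dense ideals, so that a
  generic sequence always has one.
\<close>

definition decided :: "'a set \<Rightarrow> (nat \<Rightarrow> 'a) set \<Rightarrow> bool"
  where "decided A B \<longleftrightarrow> (\<exists>\<J>. countable \<J> \<and> (\<forall>J\<in>\<J>. dense_ideal A J) \<and>
    (\<exists>J\<in>\<J>. \<forall>s\<in>J. forces A \<J> B s \<or> forces A \<J> (- B) s))"

lemma map_upt_append:
  assumes "map x [0..<length (s @ t)] = s @ t"
  shows "map x [0..<length s] = s"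
proof -
  have "take (length s) (map x [0..<length (s @ t)]) = s" unfolding assms by simp
  then show ?thesis by (simp add: take_map)
qed

lemma map_upt_extend:
  assumes "map x [0..<length s] = s" "range x \<subseteq> A" "length s \<le> n"
  obtains t where "t \<in> lists A" "map x [0..<n] = s @ t"
proof
  have "[0..<n] = [0..<length s] @ [length s..<n]"
    using upt_add_eq_append[of 0 "length s" "n - length s"] assms by simp
  then show "map x [0..<n] = s @ map x [length s..<n]" using assms by simp
  show "map x [length s..<n] \<in> lists A" using assms by (auto simp: in_lists_conv_set)
qed

lemma generic_mono: "generic \<J>' x \<Longrightarrow> \<J> \<subseteq> \<J>' \<Longrightarrow> generic \<J> x"
  unfolding generic_def by blast

lemma forces_mono: "forces A \<J> B s \<Longrightarrow> \<J> \<subseteq> \<J>' \<Longrightarrow> B \<subseteq> B' \<Longrightarrow> forces A \<J>' B' s"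
  unfolding forces_def using generic_mono by blast

lemma forces_append: "forces A \<J> B s \<Longrightarrow> forces A \<J> B (s @ t)"
  unfolding forces_def using map_upt_append by blast

text \<open>
  The standard dense open set attached to an open set \<open>P\<close>: its union with the interior of its
  complement.
\<close>

lemma dense_ideal_closure:
  assumes "P \<subseteq> lists A" "\<And>s t. s \<in> P \<Longrightarrow> t \<in> lists A \<Longrightarrow> s @ t \<in> P"
  shows "dense_ideal A (P \<union> {s \<in> lists A. \<forall>t\<in>lists A. s @ t \<notin> P})"
  unfolding dense_ideal_def
proof (intro conjI ballI)
  fix s assume s: "s \<in> lists A"
  show "\<exists>t\<in>lists A. s @ t \<in> P \<union> {s \<in> lists A. \<forall>t\<in>lists A. s @ t \<notin> P}"
  proof (cases "\<exists>t\<in>lists A. s @ t \<in> P")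
    case False
    then show ?thesis using s by (intro bexI[of _ "[]"]) auto
  qed blast
next
  fix s t assume "s \<in> P \<union> {s \<in> lists A. \<forall>t\<in>lists A. s @ t \<notin> P}" "t \<in> lists A"
  then show "s @ t \<in> P \<union> {s \<in> lists A. \<forall>t\<in>lists A. s @ t \<notin> P}"
  proof (elim UnE)
    assume "s \<in> P"
    then show ?thesis using \<open>t \<in> lists A\<close> assms(2) by simp
  next
    assume s: "s \<in> {s \<in> lists A. \<forall>t\<in>lists A. s @ t \<notin> P}"
    have "(s @ t) @ t' \<notin> P" if "t' \<in> lists A" for t'
      using s that \<open>t \<in> lists A\<close> by simp
    then show ?thesis using s \<open>t \<in> lists A\<close> by simp
  qed
qed

lemma decided_Compl: "decided A B \<Longrightarrow> decided A (- B)"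
  unfolding decided_def double_complement by (metis (no_types, lifting))

lemma decided_open:
  assumes B: "\<And>x. x \<in> B \<Longrightarrow> range x \<subseteq> A \<Longrightarrow>
    \<exists>n. \<forall>y. range y \<subseteq> A \<and> map y [0..<n] = map x [0..<n] \<longrightarrow> y \<in> B"
  shows "decided A B"
proof -
  define P where "P = {s \<in> lists A. \<forall>y. range y \<subseteq> A \<and> map y [0..<length s] = s \<longrightarrow> y \<in> B}"
  define J where "J = P \<union> {s \<in> lists A. \<forall>t\<in>lists A. s @ t \<notin> P}"
  have "dense_ideal A J"
    unfolding J_def
  proof (rule dense_ideal_closure)
    fix s t assume "s \<in> P" "t \<in> lists A"
    moreover from this have "y \<in> B" if "range y \<subseteq> A" "map y [0..<length (s @ t)] = s @ t" for y
      using map_upt_append[OF that(2)] that(1) unfolding P_def by blast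
    ultimately show "s @ t \<in> P" unfolding P_def by simp
  qed (simp add: P_def)
  moreover have "forces A {J} B s \<or> forces A {J} (- B) s" if s: "s \<in> J" for s
  proof (cases "s \<in> P")
    case True
    then show ?thesis by (auto simp: P_def forces_def)
  next
    case False
    have "x \<notin> B" if x: "range x \<subseteq> A" "map x [0..<length s] = s" for x
    proof
      assume "x \<in> B"
      then obtain n where n: "\<And>y. range y \<subseteq> A \<Longrightarrow> map y [0..<n] = map x [0..<n] \<Longrightarrow> y \<in> B"
        using B x by blast
      obtain t where t: "t \<in> lists A" "map x [0..<max n (length s)] = s @ t"
        using map_upt_extend[of x s A "max n (length s)"] x by auto
      have "y \<in> B" if "range y \<subseteq> A" "map y [0..<length (s @ t)] = s @ t" for y
      proof (rule n)
        have "length (s @ t) = max n (length s)" by (metis t(2) length_map length_upt diff_zero)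
        then have "map y [0..<max n (length s)] = map x [0..<max n (length s)]"
          using that t by simp
        then show "map y [0..<n] = map x [0..<n]" by auto
      qed (use that in simp)
      moreover have "s \<in> lists A" using s False by (auto simp: J_def)
      ultimately have "s @ t \<in> P" using t by (auto simp: P_def)
      then show False using s False t by (auto simp: J_def)
    qed
    then show ?thesis by (auto simp: forces_def)
  qed
  ultimately show ?thesis unfolding decided_def by (intro exI[of _ "{J}"]) auto
qed

text \<open>
  A prefix decides the union positively if it decides some \<open>B i\<close> positively. A prefix with no
  positive extension decides it negatively: a generic sequence through it also meets the dense ideal
  deciding \<open>B i\<close>, and there the decision for \<open>B i\<close> can only be negative.
\<close>

lemma decided_UN:
  assumes "\<And>i::nat. decided A (B i)"
  shows "decided A (\<Union>i. B i)"
proof -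
  obtain \<K> J where \<K>: "\<And>i. countable (\<K> i)" "\<And>i K. K \<in> \<K> i \<Longrightarrow> dense_ideal A K" "\<And>i. J i \<in> \<K> i"
    and J: "\<And>i s. s \<in> J i \<Longrightarrow> forces A (\<K> i) (B i) s \<or> forces A (\<K> i) (- B i) s"
    using assms unfolding decided_def by metis
  define P where "P = {s \<in> lists A. \<exists>i. forces A (\<K> i) (B i) s}"
  define K where "K = P \<union> {s \<in> lists A. \<forall>t\<in>lists A. s @ t \<notin> P}"
  define \<J> where "\<J> = insert K (\<Union>i. \<K> i)"
  have sub: "\<K> i \<subseteq> \<J>" for i by (auto simp: \<J>_def)
  have "dense_ideal A K"
    unfolding K_def by (rule dense_ideal_closure) (auto simp: P_def intro: forces_append)
  then have "\<forall>J\<in>\<J>. dense_ideal A J" using \<K> by (auto simp: \<J>_def)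
  moreover have "countable \<J>" using \<K> by (auto simp: \<J>_def)
  moreover have "forces A \<J> (\<Union>i. B i) s \<or> forces A \<J> (- (\<Union>i. B i)) s" if s: "s \<in> K" for s
  proof (cases "s \<in> P")
    case True
    then obtain i where "forces A (\<K> i) (B i) s" by (auto simp: P_def)
    then have "forces A \<J> (\<Union>i. B i) s" by (rule forces_mono[OF _ sub]) auto
    then show ?thesis ..
  next
    case False
    have "x \<notin> B i" if x: "range x \<subseteq> A" "generic \<J> x" "map x [0..<length s] = s" for x i
    proof -
      obtain n where n: "map x [0..<n] \<in> J i"
        using x(2) \<K>(3) sub unfolding generic_def by blast
      obtain t where t: "t \<in> lists A" "map x [0..<max n (length s)] = s @ t"
        using map_upt_extend[of x s A "max n (length s)"] x by auto
      obtain t' where t': "t' \<in> lists A" "map x [0..<max n (length s)] = map x [0..<n] @ t'"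
        using map_upt_extend[of x "map x [0..<n]" A "max n (length s)"] x by auto
      have "map x [0..<n] @ t' \<in> J i"
        using n t' \<K>(2,3) by (auto simp: dense_ideal_def simp del: in_lists_conv_set)
      then have "s @ t \<in> J i" using t t' by simp
      moreover have "\<not> forces A (\<K> i) (B i) (s @ t)"
        using s False t by (auto simp: K_def P_def simp del: in_lists_conv_set)
      ultimately have "forces A (\<K> i) (- B i) (s @ t)" using J by blast
      moreover have "map x [0..<length (s @ t)] = s @ t" by (metis t(2) length_map length_upt diff_zero)
      ultimately show ?thesis using x generic_mono[OF x(2) sub] unfolding forces_def by blast
    qed
    then show ?thesis by (auto simp: forces_def)
  qed
  ultimately show ?thesis unfolding decided_def by (intro exI[of _ \<J>]) (auto simp: \<J>_def)
qed

lemma decided_Int: "decided A B \<Longrightarrow> decided A C \<Longrightarrow> decided A (B \<inter> C)"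
proof -
  assume BC: "decided A B" "decided A C"
  have "decided A (\<Union>i::nat. if i = 0 then - B else - C)"
    by (rule decided_UN) (use BC in \<open>auto intro: decided_Compl\<close>)
  then have "decided A (- (\<Union>i::nat. if i = 0 then - B else - C))" by (rule decided_Compl)
  also have "- (\<Union>i::nat. if i = 0 then - B else - C) = B \<inter> C"
    by (auto split: if_splits)
  finally show ?thesis .
qed

lemma dense_ideal_letter:
  assumes "t \<in> A"
  shows "dense_ideal A {s. t \<in> set s}"
  unfolding dense_ideal_def using assms by (auto intro!: bexI[of _ "[t]"])

section \<open>Weak-* Borel sets of tetris vectors\<close>

definition word_value :: "('a \<Rightarrow> real) \<Rightarrow> (nat \<Rightarrow> 'a) \<Rightarrow> linf"
  where "word_value \<psi> x = Bcontfun (\<lambda>i. \<psi> (x i))"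

text \<open>
  \<open>Bcontfun\<close> is only meaningful for bounded functions; this is the bridge used for all vectors
  that are given by a formula.
\<close>

lemma apply_Bcontfun_seq:
  fixes a :: "nat \<Rightarrow> real"
  assumes "\<And>i. \<bar>a i\<bar> \<le> b"
  shows "apply_bcontfun (Bcontfun a) = a"
  using assms by (intro Bcontfun_inverse) (auto simp: bounded_seq_in_linf bounded_iff)

lemma topspace_weak_star: "topspace weak_star_linf = UNIV"
proof -
  have "UNIV = {x. (\<Sum>n. 0 * apply_bcontfun x n) \<in> (UNIV :: real set)}" by simp
  then have "UNIV \<in> {{x. (\<Sum>n. a n * apply_bcontfun x n) \<in> U} | (a :: nat \<Rightarrow> real) U.
        summable (\<lambda>n. \<bar>a n\<bar>) \<and> open U}"
    by (intro CollectI exI[of _ "\<lambda>_. 0"] exI[of _ UNIV]) simp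
  then have "openin weak_star_linf UNIV"
    unfolding weak_star_linf_def by (rule topology_generated_by_Basis)
  then show ?thesis using openin_subset by fastforce
qed

context
  fixes \<psi> :: "'a \<Rightarrow> real"
  assumes \<psi>: "\<And>l. \<bar>\<psi> l\<bar> \<le> 1"
begin

lemma apply_word_value: "apply_bcontfun (word_value \<psi> x) i = \<psi> (x i)"
  unfolding word_value_def using apply_Bcontfun_seq[of "\<lambda>i. \<psi> (x i)" 1] \<psi> by simp

text \<open>
  The map from letter sequences to the ball is continuous into the weak-* topology, because the tail
  of a series from \<open>\<ell>\<^sub>1\<close> is small uniformly over the ball.
\<close>

lemma weak_star_open_finitely_determined:
  assumes "openin weak_star_linf U" "word_value \<psi> x \<in> U"
  shows "\<exists>n. \<forall>y. map y [0..<n] = map x [0..<n] \<longrightarrow> word_value \<psi> y \<in> U"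
proof -
  define \<S> where "\<S> = {{x. (\<Sum>n. a n * apply_bcontfun x n) \<in> U} | (a :: nat \<Rightarrow> real) U.
        summable (\<lambda>n. \<bar>a n\<bar>) \<and> open U}"
  have "generate_topology_on \<S> U"
    using assms(1) unfolding weak_star_linf_def \<S>_def by (rule openin_topology_generated_by)
  then show ?thesis
    using assms(2)
  proof (induction rule: generate_topology_on.induct)
    case (Int U V)
    then obtain m n where mn: "\<And>y. map y [0..<m] = map x [0..<m] \<Longrightarrow> word_value \<psi> y \<in> U"
      "\<And>y. map y [0..<n] = map x [0..<n] \<Longrightarrow> word_value \<psi> y \<in> V" by auto
    have "map y [0..<m] = map x [0..<m]" "map y [0..<n] = map x [0..<n]"
      if "map y [0..<max m n] = map x [0..<max m n]" for y
      using that by auto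
    with mn show ?case by (intro exI[of _ "max m n"]) blast
  next
    case (UN K)
    then show ?case by blast
  next
    case (Basis V)
    then obtain a O' where V: "V = {x. (\<Sum>n. a n * apply_bcontfun x n) \<in> O'}"
      and a: "summable (\<lambda>n. \<bar>a n\<bar>)" and "open O'" unfolding \<S>_def by blast
    have sum: "summable (\<lambda>n. a n * \<psi> (y n))" for y
      by (rule summable_comparison_test'[OF a, of 0]) (simp add: abs_mult mult_left_le \<psi>)
    have "(\<Sum>n. a n * \<psi> (x n)) \<in> O'" using Basis V by (simp add: apply_word_value)
    then obtain e where e: "e > 0" "\<And>r. dist r (\<Sum>n. a n * \<psi> (x n)) < e \<Longrightarrow> r \<in> O'"
      using \<open>open O'\<close> unfolding open_dist by blast
    obtain N where N: "\<And>n. n \<ge> N \<Longrightarrow> norm (\<Sum>i. \<bar>a (i + n)\<bar>) < e / 2"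
      using suminf_exist_split[OF _ a, of "e / 2"] e by auto
    have "word_value \<psi> y \<in> V" if y: "map y [0..<N] = map x [0..<N]" for y
    proof -
      define d where "d n = a n * \<psi> (y n) - a n * \<psi> (x n)" for n
      have sd: "summable d" unfolding d_def by (intro summable_diff sum)
      have d0: "d i = 0" if "i < N" for i using y that by (simp add: d_def)
      have d_le: "\<bar>d i\<bar> \<le> 2 * \<bar>a i\<bar>" for i
      proof -
        have "\<bar>d i\<bar> = \<bar>a i\<bar> * \<bar>\<psi> (y i) - \<psi> (x i)\<bar>"
          by (simp add: d_def abs_mult flip: right_diff_distrib)
        also have "\<dots> \<le> \<bar>a i\<bar> * 2"
          using \<psi>[of "y i"] \<psi>[of "x i"] by (intro mult_left_mono) auto
        finally show ?thesis by simp
      qed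
      have sN: "summable (\<lambda>i. 2 * \<bar>a (i + N)\<bar>)"
        using a by (intro summable_mult) (simp add: summable_iff_shift[of "\<lambda>i. \<bar>a i\<bar>"])
      have "(\<Sum>n. a n * \<psi> (y n)) - (\<Sum>n. a n * \<psi> (x n)) = (\<Sum>n. d n)"
        unfolding d_def using suminf_diff[OF sum sum, of y x] by simp
      also have "\<dots> = (\<Sum>i. d (i + N))"
        using suminf_split_initial_segment[OF sd, of N] d0 by simp
      finally have "\<bar>(\<Sum>n. a n * \<psi> (y n)) - (\<Sum>n. a n * \<psi> (x n))\<bar> = norm (\<Sum>i. d (i + N))" by simp
      also have "\<dots> \<le> (\<Sum>i. 2 * \<bar>a (i + N)\<bar>)"
        by (rule norm_suminf_le[OF _ sN]) (use d_le in auto)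
      also have "\<dots> = 2 * (\<Sum>i. \<bar>a (i + N)\<bar>)"
        using a by (intro suminf_mult) (simp add: summable_iff_shift[of "\<lambda>i. \<bar>a i\<bar>"])
      also have "\<dots> < e" using N[of N] by simp
      finally show ?thesis using e(2) by (simp add: V apply_word_value dist_real_def)
    qed
    then show ?case by blast
  next
    case Empty
    then show ?case by blast
  qed
qed

lemma decided_weak_star_open:
  assumes "openin weak_star_linf U"
  shows "decided A {x. word_value \<psi> x \<in> U}"
proof (rule decided_open)
  fix x assume "x \<in> {x. word_value \<psi> x \<in> U}"
  then have "word_value \<psi> x \<in> U" by simp
  then obtain n where "\<And>y. map y [0..<n] = map x [0..<n] \<Longrightarrow> word_value \<psi> y \<in> U"
    using weak_star_open_finitely_determined[OF assms] by blast
  then show "\<exists>n. \<forall>y. range y \<subseteq> A \<and> map y [0..<n] = map x [0..<n] \<longrightarrow> y \<in> {x. word_value \<psi> x \<in> U}"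
    by (intro exI[of _ n]) simp
qed

lemma word_value_on_sphere:
  assumes "x i = t" "\<bar>\<psi> t\<bar> = 1"
  shows "word_value \<psi> x \<in> sphere 0 1"
proof -
  have "norm (word_value \<psi> x) \<le> 1" using \<psi> by (intro norm_bound) (simp add: apply_word_value)
  moreover have "norm (word_value \<psi> x) \<ge> 1"
    using norm_bounded[of "word_value \<psi> x" i] assms by (simp add: apply_word_value)
  ultimately show ?thesis by simp
qed

lemma decided_sphere:
  assumes "t \<in> A" "\<bar>\<psi> t\<bar> = 1"
  shows "decided A {x. word_value \<psi> x \<in> sphere 0 1}"
proof -
  have "forces A {{s. t \<in> set s}} {x. word_value \<psi> x \<in> sphere 0 1} s" if "t \<in> set s" for s
    unfolding forces_def
  proof (intro allI impI CollectI)
    fix x assume x: "range x \<subseteq> A \<and> generic {{s. t \<in> set s}} x \<and> map x [0..<length s] = s"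
    then have "t \<in> x ` {0..<length s}" using that by (metis set_map set_upt)
    then show "word_value \<psi> x \<in> sphere 0 1" using word_value_on_sphere assms(2) by blast
  qed
  then show ?thesis
    unfolding decided_def using dense_ideal_letter[OF assms(1)]
    by (intro exI[of _ "{{s. t \<in> set s}}"]) auto
qed

text \<open>
  The Borel sets of the sphere are generated from its relatively open sets by complements in the
  sphere and countable unions. The sphere itself is decided by the first occurrence of a letter of
  absolute value \<open>1\<close>.
\<close>

lemma decided_weak_star_borel:
  assumes "t \<in> A" "\<bar>\<psi> t\<bar> = 1"
    and B: "B \<in> sets (borel_of_topology (subtopology weak_star_linf (sphere 0 1)))"
  shows "decided A {x. word_value \<psi> x \<in> B}"
proof -
  let ?S = "sphere 0 1 :: linf set"
  let ?T = "subtopology weak_star_linf ?S"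
  have topspace: "topspace ?T = ?S" by (simp add: topspace_weak_star)
  have "B \<in> sigma_sets ?S {U. openin ?T U}"
    using B unfolding borel_of_topology_def topspace
    by (subst (asm) sets_measure_of) (use openin_subset[of ?T] topspace in auto)
  then show ?thesis
  proof (induction rule: sigma_sets.induct)
    case (Basic U)
    then obtain V where V: "openin weak_star_linf V" "U = V \<inter> ?S"
      by (auto simp: openin_subtopology)
    have "decided A ({x. word_value \<psi> x \<in> V} \<inter> {x. word_value \<psi> x \<in> ?S})"
      using assms V by (intro decided_Int decided_weak_star_open decided_sphere)
    then show ?case by (simp add: V Int_def)
  next
    case Empty
    show ?case using decided_open[of "{}" A] by simp
  next
    case (Compl C)
    have "decided A ({x. word_value \<psi> x \<in> ?S} \<inter> - {x. word_value \<psi> x \<in> C})"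
      using assms Compl by (intro decided_Int decided_Compl decided_sphere)
    also have "{x. word_value \<psi> x \<in> ?S} \<inter> - {x. word_value \<psi> x \<in> C} = {x. word_value \<psi> x \<in> ?S - C}"
      by auto
    finally show ?case .
  next
    case (Union C)
    have "decided A (\<Union>i. {x. word_value \<psi> x \<in> C i})" using Union by (intro decided_UN)
    also have "(\<Union>i. {x. word_value \<psi> x \<in> C i}) = {x. word_value \<psi> x \<in> (\<Union>i. C i)}" by auto
    finally show ?case .
  qed
qed

end

lemma space_borel_weak_star_sphere:
  "space (borel_of_topology (subtopology weak_star_linf (sphere 0 1))) = sphere 0 1"
  by (simp add: borel_of_topology_def topspace_weak_star space_measure_of_conv)

section \<open>Words whose shifts can be concatenated freely\<close>

text \<open>
  Finitely many dense ideals, each translated by a prefix, still have a common element; this is the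
  finite intersection property behind the next lemma.
\<close>

lemma dense_ideals_common_element:
  assumes "\<And>J. J \<in> \<J> \<Longrightarrow> dense_ideal A J" "finite F" "F \<subseteq> lists A \<times> \<J>"
  shows "\<exists>t\<in>lists A. \<forall>(s, J)\<in>F. s @ t \<in> J"
  using assms(2,3)
proof induction
  case empty
  show ?case by (intro bexI[of _ "[]"]) auto
next
  case (insert sJ F)
  obtain s J where sJ: "sJ = (s, J)" "s \<in> lists A" "J \<in> \<J>" using insert.prems by auto
  obtain t where t: "t \<in> lists A" "\<forall>(s, J)\<in>F. s @ t \<in> J" using insert by auto
  have "s @ t \<in> lists A" using sJ t by simp
  then obtain u where u: "u \<in> lists A" "(s @ t) @ u \<in> J"
    using assms(1)[OF sJ(3)] unfolding dense_ideal_def by blast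
  have "s' @ t @ u \<in> J'" if "(s', J') \<in> F" for s' J'
  proof -
    have "s' @ t \<in> J'" "J' \<in> \<J>" using t that insert.prems by auto
    then have "(s' @ t) @ u \<in> J'" using assms(1) u(1) unfolding dense_ideal_def by blast
    then show ?thesis by simp
  qed
  then show ?case using t u sJ by (intro bexI[of _ "t @ u"]) auto
qed

text \<open>
  The ultrafilters that contain all translates of the given dense ideals form a closed two-sided ideal
  in the semigroup of ultrafilters on words. It is nonempty by the finite intersection property, so
  it contains an ultrafilter absorbing all its shifts.
\<close>

lemma absorbing_ultrafilter:
  fixes k :: nat
  assumes \<J>: "\<And>J. J \<in> \<J> \<Longrightarrow> dense_ideal {..k} J"
  shows "\<exists>p. mostly p (\<lambda>s. s \<in> lists {..k}) \<and>
    (\<forall>j\<ge>1. map_ultrafilter (map (\<lambda>l. l - j)) p \<odot> p = p) \<and>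
    (\<forall>J\<in>\<J>. \<forall>s\<in>lists {..k}. mostly p (\<lambda>t. s @ t \<in> J))"
proof -
  define W where "W = lists {..k}"
  have W_append: "s @ t \<in> W \<longleftrightarrow> s \<in> W \<and> t \<in> W" for s t by (auto simp: W_def)
  define S where "S = {p. mostly p (\<lambda>s. s \<in> W)}"
  define R where "R = {p. \<forall>P \<in> insert (\<lambda>s. s \<in> W) ((\<lambda>(s, J) t. s @ t \<in> J) ` (W \<times> \<J>)). mostly p P}"
  have R_iff: "p \<in> R \<longleftrightarrow> p \<in> S \<and> (\<forall>J\<in>\<J>. \<forall>s\<in>W. mostly p (\<lambda>t. s @ t \<in> J))" for p
    by (auto simp: R_def S_def)
  define T where "T = map_ultrafilter (map (\<lambda>l::nat. l - 1))"
  have T: "(T ^^ j) p = map_ultrafilter (map (\<lambda>l. l - j)) p" for j p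
  proof (induction j)
    case 0
    show ?case by (rule ultrafilter_eqI) simp
  next
    case (Suc j)
    have diff: "(\<lambda>l::nat. l - Suc 0) \<circ> (\<lambda>l. l - j) = (\<lambda>l. l - Suc j)" by auto
    have "(T ^^ Suc j) p = T (map_ultrafilter (map (\<lambda>l. l - j)) p)" using Suc.IH by simp
    then show ?case by (simp add: T_def diff ultrafilter_eqI)
  qed
  have "\<exists>p\<in>R. \<forall>j\<ge>1. (T ^^ j) p \<odot> p = p"
  proof (rule idempotent_absorbing_shifts[where S = S and k = k])
    show "R \<subseteq> S" using R_iff by blast
    show "compact R" unfolding R_def by (rule compact_mostly_all)
    have "\<exists>U. \<forall>P \<in> insert (\<lambda>s. s \<in> W) ((\<lambda>(s, J) t. s @ t \<in> J) ` (W \<times> \<J>)). mostly U P"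
    proof (rule ultrafilter_exists)
      fix F assume F: "finite F" "F \<subseteq> insert (\<lambda>s. s \<in> W) ((\<lambda>(s, J) t. s @ t \<in> J) ` (W \<times> \<J>))"
      then have "finite (F - {\<lambda>s. s \<in> W})" "F - {\<lambda>s. s \<in> W} \<subseteq> (\<lambda>(s, J) t. s @ t \<in> J) ` (W \<times> \<J>)"
        by auto
      then obtain G where G: "G \<subseteq> W \<times> \<J>" "finite G" "F - {\<lambda>s. s \<in> W} = (\<lambda>(s, J) t. s @ t \<in> J) ` G"
        by (meson finite_subset_image)
      obtain t where t: "t \<in> W" "\<forall>(s, J)\<in>G. s @ t \<in> J"
        using dense_ideals_common_element[OF \<J> G(2)] G(1) unfolding W_def by blast
      have "P t" if "P \<in> F" for P
      proof (cases "P = (\<lambda>s. s \<in> W)")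
        case False
        then have "P \<in> (\<lambda>(s, J) t. s @ t \<in> J) ` G" using that G(3) by blast
        then show ?thesis using t(2) by auto
      qed (use t in simp)
      then show "\<exists>t. \<forall>P\<in>F. P t" by blast
    qed
    then show "R \<noteq> {}" by (auto simp: R_def)
    show "x \<odot> y \<in> S" if "x \<in> S" "y \<in> S" for x y
      using that by (simp add: S_def W_append)
    show "T x \<in> S" if "x \<in> S" for x
    proof -
      have "mostly x (\<lambda>s. map (\<lambda>l. l - 1) s \<in> W)"
        by (rule mostly_mono[of x "\<lambda>s. s \<in> W"])
           (use that in \<open>auto simp: S_def W_def in_lists_conv_set intro: le_trans[OF diff_le_self]\<close>)
      then show ?thesis by (simp add: S_def T_def)
    qed
    show "x \<odot> y \<in> R" if "x \<in> S" "y \<in> R" for x y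
    proof -
      have "mostly x (\<lambda>u. mostly y (\<lambda>t. s @ u @ t \<in> J))" if "J \<in> \<J>" "s \<in> W" for s J
      proof (rule mostly_mono[of x "\<lambda>s. s \<in> W"])
        fix u assume "u \<in> W"
        then have "mostly y (\<lambda>t. (s @ u) @ t \<in> J)"
          using \<open>y \<in> R\<close> that unfolding R_iff by (simp only: W_append)
        then show "mostly y (\<lambda>t. s @ u @ t \<in> J)" by simp
      qed (use \<open>x \<in> S\<close> in \<open>simp add: S_def\<close>)
      then show ?thesis using that by (simp add: R_iff S_def W_append)
    qed
    show "x \<odot> y \<in> R" if "x \<in> R" "y \<in> S" for x y
    proof -
      have "mostly x (\<lambda>u. mostly y (\<lambda>t. s @ u @ t \<in> J))" if "J \<in> \<J>" "s \<in> W" for s J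
      proof (rule mostly_mono[of x "\<lambda>u. s @ u \<in> J"])
        fix u assume "s @ u \<in> J"
        then have "(s @ u) @ t \<in> J" if "t \<in> W" for t
          using \<J>[OF \<open>J \<in> \<J>\<close>] that unfolding dense_ideal_def W_def by blast
        then show "mostly y (\<lambda>t. s @ u @ t \<in> J)"
          using \<open>y \<in> S\<close> unfolding S_def by (simp add: mostly_mono[of y "\<lambda>t. t \<in> W"])
      qed (use \<open>x \<in> R\<close> that in \<open>simp add: R_iff\<close>)
      then show ?thesis using that by (simp add: R_iff S_def W_append)
    qed
    \<comment> \<open>After \<open>k\<close> steps only the letter \<open>0\<close> is left.\<close>
    show "T ((T ^^ k) x) = (T ^^ k) x" if "x \<in> S" for x
    proof (rule ultrafilter_eqI)
      fix P
      have "T ((T ^^ k) x) = map_ultrafilter (map (\<lambda>l. l - Suc k)) x" using T[of "Suc k" x] by simp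
      moreover have "mostly x (\<lambda>s. P (map (\<lambda>l. l - Suc k) s)) = mostly x (\<lambda>s. P (map (\<lambda>l. l - k) s))"
      proof (rule mostly_cong)
        show "mostly x (\<lambda>s. s \<in> W)" using that by (simp add: S_def)
        fix s assume "s \<in> W"
        then have "map (\<lambda>l. l - Suc k) s = map (\<lambda>l. l - k) s" by (auto simp: W_def in_lists_conv_set)
        then show "P (map (\<lambda>l. l - Suc k) s) = P (map (\<lambda>l. l - k) s)" by (rule arg_cong)
      qed
      ultimately show "mostly (T ((T ^^ k) x)) P = mostly ((T ^^ k) x) P" by (simp add: T)
    qed
  qed (auto simp: append_ultrafilter_assoc T_def map_append_ultrafilter
         intro: continuous_on_append_ultrafilter continuous_on_map_ultrafilter)
  then obtain p where p: "p \<in> R" "\<forall>j\<ge>1. map_ultrafilter (map (\<lambda>l. l - j)) p \<odot> p = p"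
    unfolding T by blast
  have "mostly p (\<lambda>s. s \<in> lists {..k})" "\<forall>J\<in>\<J>. \<forall>s\<in>lists {..k}. mostly p (\<lambda>t. s @ t \<in> J)"
    using p(1) unfolding R_iff S_def W_def by blast+
  with p(2) show ?thesis by blast
qed

text \<open>
  The \<open>j\<close>-th shift acts on blocks over \<open>{0..k+1}\<close> and produces words over \<open>{0..k}\<close>. The \<open>0\<close>-th shift
  stands for multiplication by \<open>1\<close> but must remove the letter \<open>k+1\<close>. Since the first shift
  turns that letter into \<open>k\<close>, which has the value \<open>1\<close>, it should be replaced by a letter of value close
  to \<open>-1\<close>; this is \<open>k-1\<close>, of value \<open>-\<rho>\<close>.
\<close>

definition shift :: "nat \<Rightarrow> nat \<Rightarrow> nat \<Rightarrow> nat"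
  where "shift k j l = (if j = 0 then if l = Suc k then k - 1 else l else l - j)"

lemma shift_le: "l \<le> Suc k \<Longrightarrow> shift k j l \<le> k"
  by (auto simp: shift_def)

text \<open>
  The sequence \<open>Z\<close> lists the letters of all blocks, each together with the coordinate to which its
  block belongs; \<open>j\<close> prescribes a shift for each coordinate.
\<close>

definition substitute :: "nat \<Rightarrow> (nat \<Rightarrow> nat \<times> nat) \<Rightarrow> (nat \<Rightarrow> nat) \<Rightarrow> nat \<Rightarrow> nat"
  where "substitute k Z j i = shift k (j (fst (Z i))) (snd (Z i))"

text \<open>
  The values \<open>j v = 0\<close> and \<open>j v = 1\<close> correspond to the scalars \<open>1\<close> and \<open>-\<rho>\<close>; demanding one of them
  is the combinatorial form of the condition that the norm be \<open>1\<close>.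
\<close>

definition admissible :: "nat \<Rightarrow> (nat \<Rightarrow> nat) \<Rightarrow> bool"
  where "admissible k j \<longleftrightarrow> (\<forall>v. j v \<le> Suc k) \<and> (\<exists>v. j v \<le> 1)"

text \<open>
  Blocks are chosen typical for \<open>q = p \<odot> Suc(p)\<close>, where \<open>Suc\<close> raises all letters by \<open>1\<close>: the \<open>j\<close>-th
  shift of \<open>q\<close> is the \<open>(j-1)\<close>-st shift of \<open>p\<close>, and its \<open>0\<close>-th shift starts with \<open>p\<close>. The invariant of
  the recursion is that after each of the finitely many words built so far, under any choice of shifts,
  a \<open>p\<close>-typical continuation leads into \<open>D\<close>. A block shifted by \<open>j \<ge> 2\<close> preserves it since \<open>p\<close>
  absorbs its shifts. A block shifted by \<open>0\<close> or \<open>1\<close> is such a continuation, possibly prolonged, so it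
  leads into the ideal \<open>D\<close>, and likewise into any finite number of the ideals from \<open>\<J>\<close>.
\<close>

lemma block_sequence:
  fixes k :: nat and p :: "nat list ultrafilter"
  assumes p_words: "mostly p (\<lambda>s. s \<in> lists {..k})"
    and absorb: "\<And>j. j \<ge> 1 \<Longrightarrow> map_ultrafilter (map (\<lambda>l. l - j)) p \<odot> p = p"
    and D_ideal: "\<And>s t. s \<in> D \<Longrightarrow> t \<in> lists {..k} \<Longrightarrow> s @ t \<in> D"
    and D_large: "mostly p (\<lambda>s. s \<in> D)"
    and \<J>: "countable \<J>" "\<J> \<noteq> {}"
    and \<J>_ideal: "\<And>J s t. J \<in> \<J> \<Longrightarrow> s \<in> J \<Longrightarrow> t \<in> lists {..k} \<Longrightarrow> s @ t \<in> J"
    and \<J>_large: "\<And>J s. J \<in> \<J> \<Longrightarrow> s \<in> lists {..k} \<Longrightarrow> mostly p (\<lambda>t. s @ t \<in> J)"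
    and top: "mostly p (\<lambda>s. k \<in> set s)"
  shows "\<exists>Z :: nat \<Rightarrow> nat \<times> nat. range Z \<subseteq> UNIV \<times> {..Suc k} \<and> UNIV \<times> {k} \<subseteq> range Z \<and>
    (\<forall>j. admissible k j \<longrightarrow>
      generic \<J> (substitute k Z j) \<and> (\<exists>n. map (substitute k Z j) [0..<n] \<in> D))"
proof -
  define W where "W = lists {..k}"
  define q where "q = p \<odot> map_ultrafilter (map Suc) p"
  have q_words: "mostly q (\<lambda>u. u \<in> lists {..Suc k})"
  proof -
    have "mostly p (\<lambda>t. s @ map Suc t \<in> lists {..Suc k})" if "s \<in> lists {..k}" for s
      by (rule mostly_mono[OF p_words]) (use that in \<open>auto simp: in_lists_conv_set\<close>)
    from mostly_mono[OF p_words this] show ?thesis by (simp add: q_def)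
  qed
  have q_top: "mostly q (\<lambda>u. k \<in> set u)"
    unfolding q_def mostly_append by (rule mostly_mono[OF top]) simp
  have q_shift: "mostly q (\<lambda>u. P (map (shift k j) u)) \<longleftrightarrow> mostly p (\<lambda>u. P (map (\<lambda>l. l - (j - 1)) u))"
    if "j \<ge> 1" for j P
  proof -
    have "mostly q (\<lambda>u. P (map (shift k j) u)) \<longleftrightarrow>
      mostly (map_ultrafilter (map (\<lambda>l. l - 1)) p \<odot> p) (\<lambda>u. P (map (\<lambda>l. l - (j - 1)) u))"
      using that by (cases j) (simp_all add: q_def shift_def[abs_def] comp_def)
    then show ?thesis unfolding absorb[OF order_refl] .
  qed
  have step_pos: "mostly q (\<lambda>u. s @ map (shift k j) u \<in> B)"
    if B: "mostly p (\<lambda>t. s @ t \<in> B)" and B_ideal: "\<And>s t. s \<in> B \<Longrightarrow> t \<in> W \<Longrightarrow> s @ t \<in> B"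
      and j: "j \<le> 1" for s j B
  proof (cases "j = 0")
    case True
    have "mostly p (\<lambda>t. s @ map (shift k 0) (w @ map Suc t) \<in> B)" if w: "w \<in> W" "s @ w \<in> B" for w
    proof (rule mostly_mono[OF p_words])
      fix t assume "t \<in> lists {..k}"
      then have "map (shift k 0) (map Suc t) \<in> W"
        using shift_le by (auto simp: W_def in_lists_conv_set)
      moreover have "map (shift k 0) w = w"
        using w(1) by (auto simp: W_def in_lists_conv_set shift_def intro!: map_idI)
      ultimately show "s @ map (shift k 0) (w @ map Suc t) \<in> B"
        using B_ideal[OF w(2)] by simp
    qed
    moreover have "mostly p (\<lambda>w. w \<in> W \<and> s @ w \<in> B)" using B p_words by (simp add: W_def)
    ultimately have "mostly p (\<lambda>w. mostly p (\<lambda>t. s @ map (shift k 0) (w @ map Suc t) \<in> B))"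
      by (rule mostly_mono[rotated]) auto
    then show ?thesis using True by (simp add: q_def)
  next
    case False
    then show ?thesis using j B q_shift[of 1 "\<lambda>w. s @ w \<in> B"] by (simp add: le_Suc_eq)
  qed
  have step_any: "mostly q (\<lambda>u. mostly p (\<lambda>t. s @ map (shift k j) u @ t \<in> D))"
    if D: "mostly p (\<lambda>t. s @ t \<in> D)" for s j
  proof (cases "j \<le> 1")
    case True
    have "mostly q (\<lambda>u. s @ map (shift k j) u \<in> D)"
      by (rule step_pos[OF D]) (use D_ideal True in \<open>auto simp: W_def\<close>)
    then show ?thesis
    proof (rule mostly_mono)
      fix u assume "s @ map (shift k j) u \<in> D"
      from mostly_mono[OF p_words D_ideal[OF this]]
      show "mostly p (\<lambda>t. s @ map (shift k j) u @ t \<in> D)" by simp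
    qed
  next
    case False
    have "mostly (map_ultrafilter (map (\<lambda>l. l - (j - 1))) p \<odot> p) (\<lambda>t. s @ t \<in> D)"
      using D absorb[of "j - 1"] False by simp
    then show ?thesis using q_shift[of j "\<lambda>w. mostly p (\<lambda>t. s @ w @ t \<in> D)"] False by simp
  qed
  define st where "st j = map (\<lambda>(v, l). shift k (j v) l)" for j :: "nat \<Rightarrow> nat"
  define js where "js = {j :: nat \<Rightarrow> nat. \<forall>v. j v \<le> Suc k}"
  \<comment> \<open>Every coordinate is visited at infinitely many stages.\<close>
  define \<iota> where "\<iota> n = snd (prod_decode n)" for n
  define J where "J = from_nat_into \<J>"
  have J: "J n \<in> \<J>" for n unfolding J_def by (rule from_nat_into[OF \<J>(2)])
  define good where "good c \<longleftrightarrow> c \<in> lists (UNIV \<times> {..Suc k}) \<and>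
    (\<forall>j\<in>js. mostly p (\<lambda>t. st j c @ t \<in> D))" for c
  define ext where "ext n c c' \<longleftrightarrow> (\<exists>u. c' = c @ map (Pair (\<iota> n)) u \<and> k \<in> set u \<and>
    (\<forall>j\<in>js. j (\<iota> n) \<le> 1 \<longrightarrow> st j c' \<in> D \<and> (\<forall>m\<le>n. st j c' \<in> J m)))" for n c c'
  have st_words: "st j c \<in> W" if "c \<in> lists (UNIV \<times> {..Suc k})" for j c
    using that shift_le by (fastforce simp: W_def st_def in_lists_conv_set)
  have "\<exists>C. \<forall>n. good (C n) \<and> ext n (C n) (C (Suc n))"
  proof (rule dependent_nat_choice)
    show "\<exists>c. good c"
      using D_large by (intro exI[of _ "[]"]) (auto simp: good_def st_def)
  next
    fix c n assume c: "good c"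
    define F where "F = (\<lambda>j. st j c) ` js"
    have F: "F \<subseteq> W" using c st_words by (auto simp: F_def good_def)
    have "F \<subseteq> {w. set w \<subseteq> {..k} \<and> length w = length c}"
      using F by (auto simp: F_def W_def st_def in_lists_conv_set)
    then have finF: "finite F" using finite_lists_length_eq[of "{..k}"] finite_subset by blast
    have "\<forall>s\<in>F. \<forall>i\<in>{..Suc k}. mostly q (\<lambda>u. mostly p (\<lambda>t. s @ map (shift k i) u @ t \<in> D))"
      using step_any c by (auto simp: F_def good_def)
    then have 1: "mostly q (\<lambda>u. \<forall>s\<in>F. \<forall>i\<in>{..Suc k}. mostly p (\<lambda>t. s @ map (shift k i) u @ t \<in> D))"
      by (simp add: mostly_ball_finite finF)
    have "\<forall>s\<in>F. \<forall>i\<in>{..1}. mostly q (\<lambda>u. s @ map (shift k i) u \<in> D)"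
      using step_pos[of _ D] D_ideal c by (auto simp: F_def good_def W_def)
    then have 2: "mostly q (\<lambda>u. \<forall>s\<in>F. \<forall>i\<in>{..1}. s @ map (shift k i) u \<in> D)"
      by (simp add: mostly_ball_finite finF)
    have "mostly q (\<lambda>u. s @ map (shift k i) u \<in> J m)" if "s \<in> F" "i \<le> 1" for s i m
    proof (rule step_pos)
      show "mostly p (\<lambda>t. s @ t \<in> J m)" using that(1) F \<J>_large[OF J, of s] unfolding W_def by blast
      show "s @ t \<in> J m" if "s \<in> J m" "t \<in> W" for s t
        using \<J>_ideal[OF J] that by (simp add: W_def)
    qed fact
    then have "\<forall>s\<in>F. \<forall>i\<in>{..1}. \<forall>m\<in>{..n}. mostly q (\<lambda>u. s @ map (shift k i) u \<in> J m)" by simp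
    then have 3: "mostly q (\<lambda>u. \<forall>s\<in>F. \<forall>i\<in>{..1}. \<forall>m\<in>{..n}. s @ map (shift k i) u \<in> J m)"
      by (simp add: mostly_ball_finite finF)
    from 1 2 3 q_words q_top have "mostly q (\<lambda>u. (u \<in> lists {..Suc k} \<and> k \<in> set u) \<and>
      (\<forall>s\<in>F. \<forall>i\<in>{..Suc k}. mostly p (\<lambda>t. s @ map (shift k i) u @ t \<in> D)) \<and>
      (\<forall>s\<in>F. \<forall>i\<in>{..1}. s @ map (shift k i) u \<in> D) \<and>
      (\<forall>s\<in>F. \<forall>i\<in>{..1}. \<forall>m\<in>{..n}. s @ map (shift k i) u \<in> J m))"
      by (simp only: mostly_conj)
    then obtain u where u: "u \<in> lists {..Suc k}" "k \<in> set u"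
      "\<forall>s\<in>F. \<forall>i\<in>{..Suc k}. mostly p (\<lambda>t. s @ map (shift k i) u @ t \<in> D)"
      "\<forall>s\<in>F. \<forall>i\<in>{..1}. s @ map (shift k i) u \<in> D"
      "\<forall>s\<in>F. \<forall>i\<in>{..1}. \<forall>m\<in>{..n}. s @ map (shift k i) u \<in> J m"
      using mostly_ex by blast
    define c' where "c' = c @ map (Pair (\<iota> n)) u"
    have st': "st j c' = st j c @ map (shift k (j (\<iota> n))) u" for j
      by (simp add: c'_def st_def)
    have "good c'"
      using c u(1,3) unfolding good_def st' by (auto simp: c'_def F_def js_def in_lists_conv_set)
    moreover have "ext n c c'"
      unfolding ext_def using u(2,4,5) st' by (intro exI[of _ u]) (auto simp: c'_def F_def)
    ultimately show "\<exists>c'. good c' \<and> ext n c c'" by blast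
  qed
  then obtain C where C: "\<And>n. good (C n)" "\<And>n. ext n (C n) (C (Suc n))" by blast
  have "\<exists>d. C (n + m) = C n @ d" for n m
  proof (induction m)
    case (Suc m)
    then show ?case using C(2)[of "n + m"] by (auto simp: ext_def)
  qed simp
  then have prefix: "\<exists>d. C m = C n @ d" if "n \<le> m" for n m
    using that by (metis le_add_diff_inverse)
  have len: "n \<le> length (C n)" for n
  proof (induction n)
    case (Suc n)
    obtain u where "C (Suc n) = C n @ map (Pair (\<iota> n)) u" "k \<in> set u" using C(2)[of n] by (auto simp: ext_def)
    then show ?case using Suc by (cases u) auto
  qed simp
  \<comment> \<open>Blocks are nonempty, so position \<open>i\<close> is settled after \<open>i + 1\<close> stages.\<close>
  define Z where "Z i = C (Suc i) ! i" for i
  have Z: "map Z [0..<length (C n)] = C n" for n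
  proof (rule nth_equalityI)
    fix i assume i: "i < length (map Z [0..<length (C n)])"
    have "i < length (C (Suc i))" using len[of "Suc i"] by simp
    then have "C (Suc i) ! i = C n ! i"
      using prefix[of n "Suc i"] prefix[of "Suc i" n] i
      by (cases "n \<le> Suc i") (auto simp: nth_append)
    then show "map Z [0..<length (C n)] ! i = C n ! i" using i by (simp add: Z_def)
  qed simp
  have Z_range: "Z i \<in> UNIV \<times> {..Suc k}" for i
    using C(1)[of "Suc i"] len[of "Suc i"] nth_mem[of i "C (Suc i)"]
    unfolding good_def Z_def in_lists_conv_set by auto
  have Z_surj: "(v, k) \<in> range Z" for v
  proof -
    define n where "n = prod_encode (0, v)"
    have "(v, k) \<in> set (C (Suc n))"
      using C(2)[of n] by (auto simp: ext_def \<iota>_def n_def)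
    then have "(v, k) \<in> set (map Z [0..<length (C (Suc n))])" by (simp only: Z)
    then show ?thesis by auto
  qed
  have Z_hit: "generic \<J> (substitute k Z j)" "\<exists>n. map (substitute k Z j) [0..<n] \<in> D"
    if admissible: "admissible k j" for j
  proof -
    obtain v where j: "j \<in> js" "j v \<le> 1"
      using admissible unfolding admissible_def js_def mem_Collect_eq by blast
    have x: "map (substitute k Z j) [0..<length (C n)] = st j (C n)" for n
    proof -
      have "map (substitute k Z j) [0..<length (C n)] = st j (map Z [0..<length (C n)])"
        by (simp add: substitute_def st_def case_prod_beta)
      then show ?thesis by (simp only: Z)
    qed
    have hit: "st j (C (Suc n)) \<in> D \<and> st j (C (Suc n)) \<in> J m" if "n = prod_encode (m, v)" for m n
    proof -
      have "m \<le> n" using that le_prod_encode_1 by simp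
      then show ?thesis using C(2)[of n] j that by (auto simp: ext_def \<iota>_def)
    qed
    show "\<exists>n. map (substitute k Z j) [0..<n] \<in> D" using hit[of _ 0] x by metis
    have "\<exists>n. map (substitute k Z j) [0..<n] \<in> J m" for m using hit[of _ m] x by metis
    then show "generic \<J> (substitute k Z j)"
      unfolding generic_def J_def using \<J> by (metis from_nat_into_surj)
  qed
  show ?thesis
  proof (intro exI[of _ Z] conjI allI impI)
    show "range Z \<subseteq> UNIV \<times> {..Suc k}" "UNIV \<times> {k} \<subseteq> range Z" using Z_range Z_surj by blast+
  qed (use Z_hit in blast)+
qed

section \<open>Scalars as shifts\<close>

text \<open>
  The analogue of Gowers' tetris functions: consecutive letters differ in value by the
  factor \<open>-\<rho>\<close>, and the letter \<open>k\<close> has the value \<open>1\<close>.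
\<close>

definition tetris :: "real \<Rightarrow> nat \<Rightarrow> nat \<Rightarrow> real"
  where "tetris \<rho> k l = (if l = 0 then 0 else (- \<rho>) ^ (k - l))"

lemma abs_tetris_le: "0 \<le> \<rho> \<Longrightarrow> \<rho> \<le> 1 \<Longrightarrow> \<bar>tetris \<rho> k l\<bar> \<le> 1"
  by (simp add: tetris_def power_abs power_le_one)

lemma tetris_top: "k > 0 \<Longrightarrow> tetris \<rho> k k = 1"
  by (simp add: tetris_def)

text \<open>
  Shifting by \<open>j > 0\<close> is exactly multiplication by \<open>(-\<rho>)\<^sup>j\<close> as long as the letter stays positive. Errors arise from letters that
  drop to \<open>0\<close>, whose value was at most \<open>\<rho>\<^sup>k\<close>, and from the extra letter \<open>k+1\<close>.
\<close>

lemma tetris_shift: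
  assumes \<rho>: "0 < \<rho>" "\<rho> < 1" and k: "k \<ge> 2" "\<rho> ^ k \<le> 1 - \<rho>" and l: "l \<le> Suc k"
  shows "\<bar>(- \<rho>) ^ j * tetris \<rho> k (shift k 0 l) - tetris \<rho> k (shift k j l)\<bar> \<le> 2 * (1 - \<rho>)"
proof -
  have small: "\<bar>(- \<rho>) ^ n\<bar> \<le> 2 * (1 - \<rho>)" if "n \<ge> k" for n
  proof -
    have "\<bar>(- \<rho>) ^ n\<bar> = \<rho> ^ n" using \<rho> by (simp add: power_abs)
    also have "\<dots> \<le> \<rho> ^ k" using \<rho> that by (intro power_decreasing) auto
    also have "\<dots> \<le> 1 * (1 - \<rho>)" using k by simp
    also have "\<dots> \<le> 2 * (1 - \<rho>)" using \<rho> by (intro mult_right_mono) auto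
    finally show ?thesis .
  qed
  consider "j = 0" | "l = 0" | "0 < j" "j < l" "l \<le> k" | "0 < l" "l \<le> j" "l \<le> k"
    | "l = Suc k" "0 < j" "j \<le> k" | "l = Suc k" "k < j" using l by linarith
  then show ?thesis
  proof cases
    case 1
    then show ?thesis using \<rho> by simp
  next
    case 2
    then show ?thesis using \<rho> by (simp add: shift_def tetris_def)
  next
    case 3
    then have exponent: "k - (l - j) = j + (k - l)" by simp
    have "tetris \<rho> k (shift k j l) = (- \<rho>) ^ (k - (l - j))" using 3 by (simp add: shift_def tetris_def)
    also have "\<dots> = (- \<rho>) ^ j * tetris \<rho> k (shift k 0 l)"
      unfolding exponent power_add using 3 by (simp add: shift_def tetris_def)
    finally show ?thesis using \<rho> by simp
  next
    case 4
    then have vals: "tetris \<rho> k (shift k 0 l) = (- \<rho>) ^ (k - l)" "tetris \<rho> k (shift k j l) = 0"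
      by (simp_all add: shift_def tetris_def)
    have "k \<le> j + (k - l)" using 4 by simp
    from small[OF this] show ?thesis by (simp only: vals power_add diff_zero)
  next
    case 5
    have square_le: "\<rho> * \<rho> \<le> 1" using \<rho> by (simp add: mult_le_one)
    obtain i where i: "j = Suc i" using 5 by (cases j) auto
    have "(- \<rho>) ^ j * tetris \<rho> k (shift k 0 l) - tetris \<rho> k (shift k j l) = (- \<rho>) ^ i * (\<rho> * \<rho> - 1)"
      using 5 k i by (simp add: shift_def tetris_def algebra_simps)
    also have "\<bar>\<dots>\<bar> = \<rho> ^ i * (1 - \<rho> * \<rho>)"
      using \<rho> square_le by (simp add: abs_mult power_abs)
    also have "\<dots> \<le> 1 * (1 - \<rho> * \<rho>)"
      using \<rho> square_le by (intro mult_right_mono power_le_one) auto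
    also have "\<dots> = (1 + \<rho>) * (1 - \<rho>)" by (simp add: algebra_simps)
    also have "\<dots> \<le> 2 * (1 - \<rho>)" using \<rho> by (intro mult_right_mono) auto
    finally show ?thesis .
  next
    case 6
    then have "tetris \<rho> k (shift k 0 l) = - \<rho>" "tetris \<rho> k (shift k j l) = 0"
      using k by (simp_all add: shift_def tetris_def)
    then show ?thesis using small[of "Suc j"] 6 by (simp add: mult.commute)
  qed
qed

text \<open>
  If \<open>\<bar>y\<bar> > \<rho>\<^sup>k\<close>, exactly one of the two consecutive powers of \<open>-\<rho>\<close> whose absolute values enclose
  \<open>\<bar>y\<bar>\<close> has the sign of \<open>y\<close>. All smaller \<open>y\<close> are rounded to the negligible power with exponent \<open>k+1\<close>.
\<close>

lemma nearby_signed_power: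
  fixes \<rho> y :: real
  assumes \<rho>: "0 < \<rho>" "\<rho> < 1" and k: "k \<ge> 1" "\<rho> ^ k \<le> 1 - \<rho>" and y: "\<bar>y\<bar> \<le> 1"
  shows "\<exists>j\<le>Suc k. \<bar>y - (- \<rho>) ^ j\<bar> \<le> 2 * (1 - \<rho>) \<and> (\<rho> < \<bar>y\<bar> \<longrightarrow> j \<le> 1)"
proof (cases "\<bar>y\<bar> \<le> \<rho> ^ k")
  case True
  have "\<bar>(- \<rho>) ^ Suc k\<bar> = \<rho> ^ Suc k" unfolding power_abs using \<rho> by simp
  then have "\<bar>(- \<rho>) ^ Suc k\<bar> \<le> \<rho> ^ k" using \<rho> power_decreasing[of k "Suc k" \<rho>] by simp
  then have "\<bar>y\<bar> + \<bar>(- \<rho>) ^ Suc k\<bar> \<le> (1 - \<rho>) + (1 - \<rho>)"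
    using True k by (intro add_mono) auto
  from order_trans[OF abs_triangle_ineq4 this]
  have "\<bar>y - (- \<rho>) ^ Suc k\<bar> \<le> 2 * (1 - \<rho>)" by (simp only: mult_2)
  moreover have "\<rho> ^ k \<le> \<rho>" using \<rho> k by (metis power_decreasing power_one_right less_imp_le)
  ultimately show ?thesis using True by (intro exI[of _ "Suc k"]) auto
next
  case False
  define i where "i = (LEAST i. \<rho> ^ Suc i < \<bar>y\<bar>)"
  have k1: "\<rho> ^ Suc (k - 1) < \<bar>y\<bar>" using False k by simp
  have i: "\<rho> ^ Suc i < \<bar>y\<bar>" unfolding i_def by (rule LeastI[of "\<lambda>i. \<rho> ^ Suc i < \<bar>y\<bar>", OF k1])
  have ik: "i \<le> k - 1" unfolding i_def by (rule Least_le[of "\<lambda>i. \<rho> ^ Suc i < \<bar>y\<bar>", OF k1])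
  have yi: "\<bar>y\<bar> \<le> \<rho> ^ i"
  proof (cases i)
    case (Suc i')
    then have "\<not> \<rho> ^ Suc i' < \<bar>y\<bar>" using not_less_Least[of i' "\<lambda>i. \<rho> ^ Suc i < \<bar>y\<bar>"] by (simp add: i_def)
    then show ?thesis using Suc by simp
  qed (use y in simp)
  have i0: "i \<le> 0" if "\<rho> < \<bar>y\<bar>" unfolding i_def by (rule Least_le[of "\<lambda>i. \<rho> ^ Suc i < \<bar>y\<bar>"]) (use that in simp)
  have gap: "\<rho> ^ i - \<rho> ^ Suc i \<le> 1 - \<rho>"
  proof -
    have "\<rho> ^ i * (1 - \<rho>) \<le> 1 * (1 - \<rho>)" using \<rho> by (intro mult_right_mono power_le_one) auto
    then show ?thesis by (simp add: algebra_simps)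
  qed
  define j where "j = (if (y > 0) = even i then i else Suc i)"
  have y0: "y \<noteq> 0" using False \<rho> by auto
  have "\<bar>y - (- \<rho>) ^ j\<bar> \<le> 1 - \<rho>"
    using i yi gap y0 by (cases "even i"; cases "y > 0") (auto simp: j_def)
  also have "\<dots> \<le> 2 * (1 - \<rho>)" using \<rho> by simp
  finally have "\<bar>y - (- \<rho>) ^ j\<bar> \<le> 2 * (1 - \<rho>)" .
  moreover have "j \<le> Suc k" "\<rho> < \<bar>y\<bar> \<longrightarrow> j \<le> 1" using ik i0 by (auto simp: j_def)
  ultimately show ?thesis by blast
qed

text \<open>
  Repeating coordinates with weights in \<open>[-1,1]\<close> is a contraction, and it is isometric because each
  coordinate occurs with weight \<open>1\<close>.
\<close>

lemma weighted_copy: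
  fixes V :: "nat \<Rightarrow> nat" and \<beta> :: "nat \<Rightarrow> real"
  defines "T \<equiv> \<lambda>y :: linf. Bcontfun (\<lambda>i. apply_bcontfun y (V i) * \<beta> i) :: linf"
  assumes \<beta>: "\<And>i. \<bar>\<beta> i\<bar> \<le> 1" and V: "\<And>v. \<exists>i. V i = v \<and> \<beta> i = 1"
  shows "apply_bcontfun (T y) i = apply_bcontfun y (V i) * \<beta> i" "linear T" "norm (T y) = norm y"
proof -
  have bound: "\<bar>apply_bcontfun y (V i) * \<beta> i\<bar> \<le> norm y" for y :: linf and i
    using mult_mono[OF norm_bounded[of y "V i"] \<beta>[of i]] by (simp add: abs_mult)
  have T: "apply_bcontfun (T y) i = apply_bcontfun y (V i) * \<beta> i" for y i
    unfolding T_def by (subst apply_Bcontfun_seq[OF bound]) (rule refl)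
  then show "apply_bcontfun (T y) i = apply_bcontfun y (V i) * \<beta> i" .
  show "linear T"
    by (rule linearI; rule bcontfun_eqI) (simp_all add: T algebra_simps)
  show "norm (T y) = norm y"
  proof (rule antisym)
    show "norm (T y) \<le> norm y" by (rule norm_bound) (use bound T in simp)
    show "norm y \<le> norm (T y)"
    proof (rule norm_bound)
      fix v
      obtain i where "V i = v" "\<beta> i = 1" using V by blast
      then show "norm (apply_bcontfun y v) \<le> norm (T y)" using norm_bounded[of "T y" i] by (simp add: T)
    qed
  qed
qed

section \<open>Stabilization\<close>

text \<open>
  The set \<open>G\<close> consists of the vectors of the generic sequences having a prefix in \<open>D\<close>, and \<open>D\<close> is
  the set of words that decide, for every ball of a finite cover of \<open>K\<close>, whether \<open>f\<close> maps into it, in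
  the way preferred by \<open>p\<close>. All points of \<open>G\<close> thus lie in the same preimages of balls, and any ball
  containing one value of \<open>f\<close> on \<open>G\<close> contains all of them.
\<close>

lemma monochromatic_copy:
  fixes f :: "linf \<Rightarrow> 'k::metric_space" and r :: real
  assumes "compact K" "r > 0"
    and f_K: "f \<in> sphere 0 1 \<rightarrow> K"
    and f: "f \<in> borel_of_topology (subtopology weak_star_linf (sphere 0 1)) \<rightarrow>\<^sub>M restrict_space borel K"
    and \<rho>: "0 < \<rho>" "\<rho> < 1" and k: "k \<ge> 1"
  shows "\<exists>Z :: nat \<Rightarrow> nat \<times> nat. range Z \<subseteq> UNIV \<times> {..Suc k} \<and> UNIV \<times> {k} \<subseteq> range Z \<and>
    (\<exists>G \<subseteq> sphere 0 1. (\<forall>x\<in>G. \<forall>y\<in>G. dist (f x) (f y) < r) \<and>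
      (\<forall>j. admissible k j \<longrightarrow>
        word_value (tetris \<rho> k) (substitute k Z j) \<in> G))"
proof -
  let ?M = "borel_of_topology (subtopology weak_star_linf (sphere 0 1))"
  let ?\<psi> = "tetris \<rho> k"
  have \<psi>: "\<bar>?\<psi> l\<bar> \<le> 1" for l using abs_tetris_le \<rho> by simp
  have \<psi>k: "k \<in> {..k}" "\<bar>?\<psi> k\<bar> = 1" using tetris_top k by simp_all
  obtain C where C: "finite C" "K \<subseteq> (\<Union>c\<in>C. ball c (r / 2))"
    using \<open>compact K\<close> \<open>r > 0\<close> unfolding compact_eq_totally_bounded by (meson half_gt_zero)
  define B where "B c = {x. word_value ?\<psi> x \<in> f -` (ball c (r / 2) \<inter> K) \<inter> space ?M}" for c
  have "decided {..k} (B c)" for c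
  proof -
    have "ball c (r / 2) \<inter> K \<in> sets (restrict_space borel K)"
      unfolding sets_restrict_space by (rule image_eqI[of _ _ "ball c (r / 2)"]) auto
    from measurable_sets[OF f this] show ?thesis
      unfolding B_def by (rule decided_weak_star_borel[where \<psi> = ?\<psi> and t = k, OF \<psi> \<psi>k])
  qed
  then obtain \<K> J where \<K>: "\<And>c. countable (\<K> c)" "\<And>c K. K \<in> \<K> c \<Longrightarrow> dense_ideal {..k} K" "\<And>c. J c \<in> \<K> c"
    and J: "\<And>c s. s \<in> J c \<Longrightarrow> forces {..k} (\<K> c) (B c) s \<or> forces {..k} (\<K> c) (- B c) s"
    unfolding decided_def by metis
  define \<J> where "\<J> = insert {s. k \<in> set s} (\<Union>c\<in>C. \<K> c)"
  have dense: "dense_ideal {..k} J" if "J \<in> \<J>" for J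
    using that \<K>(2) dense_ideal_letter[OF \<psi>k(1)] by (auto simp: \<J>_def)
  obtain p where p: "mostly p (\<lambda>s. s \<in> lists {..k})"
    "\<And>j. j \<ge> 1 \<Longrightarrow> map_ultrafilter (map (\<lambda>l. l - j)) p \<odot> p = p"
    "\<And>J s. J \<in> \<J> \<Longrightarrow> s \<in> lists {..k} \<Longrightarrow> mostly p (\<lambda>t. s @ t \<in> J)"
    using absorbing_ultrafilter[of \<J> k, OF dense] by blast
  have p': "mostly p (\<lambda>t. t \<in> J)" if "J \<in> \<J>" for J using p(3)[OF that, of "[]"] by simp
  \<comment> \<open>The answer on which \<open>p\<close>-almost all words agree.\<close>
  define \<sigma> where "\<sigma> c = (if mostly p (forces {..k} (\<K> c) (B c)) then B c else - B c)" for c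
  define D where "D = {s. \<forall>c\<in>C. forces {..k} (\<K> c) (\<sigma> c) s}"
  have "mostly p (forces {..k} (\<K> c) (\<sigma> c))" if "c \<in> C" for c
  proof (cases "mostly p (forces {..k} (\<K> c) (B c))")
    case False
    have "mostly p (\<lambda>s. s \<in> J c)" using p' \<K>(3) that by (auto simp: \<J>_def)
    then have "mostly p (\<lambda>s. s \<in> J c \<and> \<not> forces {..k} (\<K> c) (B c) s)" using False by simp
    then have "mostly p (forces {..k} (\<K> c) (- B c))" by (rule mostly_mono) (use J in blast)
    then show ?thesis using False by (simp add: \<sigma>_def)
  qed (simp add: \<sigma>_def)
  then have D_large: "mostly p (\<lambda>s. s \<in> D)"
    unfolding D_def mem_Collect_eq
    using mostly_ball_finite[OF C(1), of p "\<lambda>c. forces {..k} (\<K> c) (\<sigma> c)"] by blast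
  have "countable \<J>" using \<K>(1) C(1) by (auto simp: \<J>_def countable_finite)
  moreover have "\<J> \<noteq> {}" by (simp add: \<J>_def)
  moreover have "s @ t \<in> D" if "s \<in> D" for s t
    using that unfolding D_def mem_Collect_eq by (blast intro: forces_append)
  moreover have "s @ t \<in> J" if "J \<in> \<J>" "s \<in> J" "t \<in> lists {..k}" for J s t
    using dense[OF that(1)] that unfolding dense_ideal_def by blast
  moreover have "mostly p (\<lambda>s. k \<in> set s)" using p'[of "{s. k \<in> set s}"] by (simp add: \<J>_def)
  ultimately have "\<exists>Z :: nat \<Rightarrow> nat \<times> nat. range Z \<subseteq> UNIV \<times> {..Suc k} \<and> UNIV \<times> {k} \<subseteq> range Z \<and>
    (\<forall>j. admissible k j \<longrightarrow>
      generic \<J> (substitute k Z j) \<and>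
      (\<exists>n. map (substitute k Z j) [0..<n] \<in> D))"
    by (intro block_sequence[OF p(1,2) _ D_large _ _ _ p(3)]) blast+
  then obtain Z where Z: "range Z \<subseteq> UNIV \<times> {..Suc k}" "UNIV \<times> {k} \<subseteq> range Z"
    and hit: "\<forall>j. admissible k j \<longrightarrow>
      generic \<J> (substitute k Z j) \<and>
      (\<exists>n. map (substitute k Z j) [0..<n] \<in> D)"
    by (elim exE conjE) (rule that)
  define G where "G = {word_value ?\<psi> x | x. range x \<subseteq> {..k} \<and> generic \<J> x \<and> (\<exists>n. map x [0..<n] \<in> D)}"
  have G_sphere: "z \<in> sphere 0 1" if z: "z \<in> G" for z
  proof -
    obtain x where x: "z = word_value ?\<psi> x" "generic \<J> x" using z unfolding G_def by blast
    then obtain n where "k \<in> set (map x [0..<n])" by (auto simp: generic_def \<J>_def)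
    then obtain i where "x i = k" by auto
    then show ?thesis using word_value_on_sphere[where \<psi> = ?\<psi>, OF \<psi> _ \<psi>k(2)] x(1) by blast
  qed
  have G_ball: "f z \<in> ball c (r / 2) \<longleftrightarrow> \<sigma> c = B c" if z: "z \<in> G" and c: "c \<in> C" for z c
  proof -
    obtain x n where x: "z = word_value ?\<psi> x" "range x \<subseteq> {..k}" "generic \<J> x" "map x [0..<n] \<in> D"
      using z unfolding G_def by blast
    have "generic (\<K> c) x" using generic_mono[OF x(3)] c by (auto simp: \<J>_def)
    moreover have "forces {..k} (\<K> c) (\<sigma> c) (map x [0..<n])" using x(4) c by (auto simp: D_def)
    ultimately have "x \<in> \<sigma> c" using x(2) unfolding forces_def by simp
    moreover have "x \<in> B c \<longleftrightarrow> f z \<in> ball c (r / 2)"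
      using G_sphere[OF z] f_K x(1) by (auto simp: B_def space_borel_weak_star_sphere)
    ultimately show ?thesis by (auto simp: \<sigma>_def split: if_splits)
  qed
  have G_close: "dist (f x) (f y) < r" if xy: "x \<in> G" "y \<in> G" for x y
  proof -
    have "f x \<in> K" using G_sphere[OF xy(1)] f_K by blast
    then obtain c where c: "c \<in> C" "f x \<in> ball c (r / 2)" using C(2) by blast
    then have "f y \<in> ball c (r / 2)" using G_ball xy by blast
    then show ?thesis using c(2) dist_triangle_half_r[of c "f x" r "f y"] by simp
  qed
  have G_hit: "word_value ?\<psi> (substitute k Z j) \<in> G"
    if j: "admissible k j" for j
  proof -
    have "snd (Z i) \<le> Suc k" for i
    proof -
      have "Z i \<in> UNIV \<times> {..Suc k}" using Z(1) by blast
      then show ?thesis by (cases "Z i") simp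
    qed
    then have "substitute k Z j i \<le> k" for i unfolding substitute_def by (rule shift_le)
    then have "range (substitute k Z j) \<subseteq> {..k}" by blast
    then show ?thesis using hit j unfolding G_def by blast
  qed
  have "G \<subseteq> sphere 0 1" using G_sphere by blast
  with Z G_close G_hit show ?thesis by (intro exI[of _ Z] exI[of _ G] conjI ballI allI impI)
qed

theorem theorem1p1:
  fixes K :: "'k::metric_space set" and f :: "linf \<Rightarrow> 'k"
  assumes "compact K"
    and "f \<in> sphere 0 1 \<rightarrow> K"
    and "f \<in> borel_of_topology (subtopology weak_star_linf (sphere 0 1))
               \<rightarrow>\<^sub>M restrict_space borel K"
    and "uniformly_continuous_on (sphere 0 1) f"
  shows "stabilizes f"
  unfolding stabilizes_def
proof (intro allI impI)
  fix \<epsilon> :: real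
  assume "\<epsilon> > 0"
  then obtain \<eta> where \<eta>: "\<eta> > 0"
    "\<And>x y. x \<in> sphere 0 1 \<Longrightarrow> y \<in> sphere 0 1 \<Longrightarrow> dist x y < \<eta> \<Longrightarrow> dist (f x) (f y) < \<epsilon> / 3"
    using assms(4) unfolding uniformly_continuous_on_def by (metis divide_pos_pos zero_less_numeral)
  \<comment> \<open>Rounding a vector costs at most \<open>4 (1 - \<rho>)\<close>.\<close>
  define \<rho> where "\<rho> = 1 - min (1 / 2) (\<eta> / 5)"
  have \<rho>: "0 < \<rho>" "\<rho> < 1" "4 * (1 - \<rho>) < \<eta>" using \<eta>(1) by (auto simp: \<rho>_def min_def)
  obtain n where "\<rho> ^ n < 1 - \<rho>" using real_arch_pow_inv[of "1 - \<rho>" \<rho>] \<rho> by auto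
  moreover define k where "k = n + 2"
  moreover have "\<rho> ^ k \<le> \<rho> ^ n" unfolding k_def using \<rho> by (intro power_decreasing) auto
  ultimately have k: "k \<ge> 2" "k \<ge> 1" "\<rho> ^ k \<le> 1 - \<rho>" by auto
  obtain Z G where Z: "range Z \<subseteq> UNIV \<times> {..Suc k}" "UNIV \<times> {k} \<subseteq> range Z"
    and G: "G \<subseteq> sphere 0 1" "\<And>x y. x \<in> G \<Longrightarrow> y \<in> G \<Longrightarrow> dist (f x) (f y) < \<epsilon> / 3"
    and hit: "\<And>j. admissible k j \<Longrightarrow>
      word_value (tetris \<rho> k) (substitute k Z j) \<in> G"
    using monochromatic_copy[OF assms(1) _ assms(2,3) \<rho>(1,2) k(2), of "\<epsilon> / 3"] \<open>\<epsilon> > 0\<close> by auto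
  define \<beta> where "\<beta> i = tetris \<rho> k (shift k 0 (snd (Z i)))" for i
  define T where "T y = (Bcontfun (\<lambda>i. apply_bcontfun y (fst (Z i)) * \<beta> i) :: linf)" for y :: linf
  have \<beta>: "\<bar>\<beta> i\<bar> \<le> 1" for i using abs_tetris_le \<rho> by (simp add: \<beta>_def)
  have "\<exists>i. fst (Z i) = v \<and> \<beta> i = 1" for v
  proof -
    have "(v, k) \<in> range Z" using Z(2) by blast
    then obtain i where "Z i = (v, k)" by (metis imageE)
    then show ?thesis using tetris_top[of k \<rho>] k by (intro exI[of _ i]) (simp add: \<beta>_def shift_def)
  qed
  note T = weighted_copy[of \<beta> "\<lambda>i. fst (Z i)", OF \<beta> this, folded T_def]
  \<comment> \<open>Each entry of \<open>y\<close> is replaced by a nearby power of \<open>-\<rho>\<close>, and multiplication by it by a shift.\<close>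
  have near: "\<exists>g\<in>G. dist z g < \<eta>" if z: "z \<in> range T \<inter> sphere 0 1" for z
  proof -
    obtain y where y: "z = T y" "norm y = 1" using z T(3) by auto
    have y_le: "\<bar>apply_bcontfun y v\<bar> \<le> 1" for v using norm_bounded[of y v] y by simp
    obtain j where j: "\<And>v. j v \<le> Suc k" "\<And>v. \<bar>apply_bcontfun y v - (- \<rho>) ^ j v\<bar> \<le> 2 * (1 - \<rho>)"
      "\<And>v. \<rho> < \<bar>apply_bcontfun y v\<bar> \<Longrightarrow> j v \<le> 1"
      using nearby_signed_power[OF \<rho>(1,2) k(2,3) y_le] by metis
    have "\<exists>v. \<rho> < \<bar>apply_bcontfun y v\<bar>"
    proof (rule ccontr)
      assume "\<nexists>v. \<rho> < \<bar>apply_bcontfun y v\<bar>"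
      then have "norm y \<le> \<rho>" by (intro norm_bound) (auto simp: not_less)
      then show False using y \<rho> by simp
    qed
    then have "\<exists>v. j v \<le> 1" using j(3) by blast
    define x where "x = substitute k Z j"
    have "word_value (tetris \<rho> k) x \<in> G"
      unfolding x_def using hit j(1) \<open>\<exists>v. j v \<le> 1\<close> by (simp add: admissible_def)
    have "dist (T y) (word_value (tetris \<rho> k) x) \<le> 4 * (1 - \<rho>)"
    proof (rule dist_bound)
      fix i
      let ?v = "fst (Z i)" and ?l = "snd (Z i)"
      have "Z i \<in> UNIV \<times> {..Suc k}" using Z(1) by blast
      then have "?l \<le> Suc k" by (cases "Z i") simp
      then have "\<bar>(- \<rho>) ^ j ?v * \<beta> i - tetris \<rho> k (x i)\<bar> \<le> 2 * (1 - \<rho>)"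
        unfolding \<beta>_def x_def substitute_def by (rule tetris_shift[OF \<rho>(1,2) k(1,3)])
      moreover have "\<bar>(apply_bcontfun y ?v - (- \<rho>) ^ j ?v) * \<beta> i\<bar> \<le> 2 * (1 - \<rho>) * 1"
        unfolding abs_mult by (intro mult_mono j(2) \<beta>) (use \<rho> in auto)
      ultimately have "\<bar>apply_bcontfun y ?v * \<beta> i - tetris \<rho> k (x i)\<bar> \<le> 4 * (1 - \<rho>)"
        by (simp add: left_diff_distrib)
      then show "dist (apply_bcontfun (T y) i) (apply_bcontfun (word_value (tetris \<rho> k) x) i) \<le> 4 * (1 - \<rho>)"
        using apply_word_value[of "tetris \<rho> k" x i] abs_tetris_le[of \<rho> k] \<rho> T(1)[of y i]
        by (simp add: dist_real_def)
    qed
    then have "dist z (word_value (tetris \<rho> k) x) < \<eta>" unfolding y(1) using \<rho>(3) by (rule le_less_trans)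
    with \<open>word_value (tetris \<rho> k) x \<in> G\<close> show ?thesis by blast
  qed
  have "dist (f z) (f z') \<le> \<epsilon>" if z: "z \<in> range T \<inter> sphere 0 1" "z' \<in> range T \<inter> sphere 0 1" for z z'
  proof -
    obtain g g' where g: "g \<in> G" "dist z g < \<eta>" "g' \<in> G" "dist z' g' < \<eta>" using near z by blast
    have "dist (f z) (f g) < \<epsilon> / 3" "dist (f z') (f g') < \<epsilon> / 3" "dist (f g) (f g') < \<epsilon> / 3"
      using \<eta>(2) g G z by blast+
    then show ?thesis
      using dist_triangle[of "f z" "f z'" "f g"] dist_triangle[of "f g" "f z'" "f g'"]
      by (simp add: dist_commute)
  qed
  then have "osc (range T \<inter> sphere 0 1) f \<le> ennreal \<epsilon>"
    unfolding osc_def by (intro SUP_least ennreal_leI)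
  moreover have "subspace (range T)" by (rule linear_subspace_image[OF T(2) subspace_UNIV])
  moreover have "linearly_isometric_to_linf (range T)"
    unfolding linearly_isometric_to_linf_def using T(2,3) by blast
  ultimately show "\<exists>Y. subspace Y \<and> linearly_isometric_to_linf Y \<and> osc (Y \<inter> sphere 0 1) f \<le> ennreal \<epsilon>"
    by blast
qed

end
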